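(* Let $\psi\colon(0,\infty)\to(0,\infty)$ be a nonincreasing function with $\lim_{x\to+\infty}\psi(x)=0$, and let $\lambda(\psi)=\liminf_{x\to\infty}\frac{-\log\psi(x)}{\log x}$. Let \[W(\psi)=\bigl\{z\in\mathbb D^*: |z-p/q|\le\psi(|q|)\text{ for infinitely many }p,q\in\mathbb Z[i]\bigr\}.\] Then $\dim_{\mathrm H}W(\psi)=\min\bigl(4/\lambda(\psi),2\bigr)$ and $\dim_{\mathrm P}W(\psi)=2$, where $\dim_{\mathrm H}$ and $\dim_{\mathrm P}$ denote Hausdorff and packing dimension.
   Context: $\mathbb D=\{x+iy: x,y\in[-1/2,1/2)\}$ and $\mathbb D^*=\mathbb D\setminus\{0\}$. If $\lambda(\psi)=\infty$, $4/\lambda(\psi)$ is interpreted as $0$. *)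

theory Defs
  imports "HOL-Analysis.Analysis"
begin

text \<open>
  The summand \<open>|U|\<^sup>s\<close>, with the usual conventions \<open>|{}|\<^sup>s = 0\<close> and \<open>|U|\<^sup>0 = 1\<close> for nonempty \<open>U\<close>.
  The case distinction is needed because \<^term>\<open>(0::real) powr 0 = 0\<close>.
\<close>

definition diam_pow :: "real \<Rightarrow> 'a::metric_space set \<Rightarrow> ennreal" where
  "diam_pow s U =
     (if U = {} then 0 else if s = 0 then 1 else ennreal (diameter U powr s))"

text \<open>
  Boundedness of the covering sets is explicit because \<^const>\<open>diameter\<close> is
  only meaningful on bounded sets.
\<close>

definition hausdorff_premeasure :: "real \<Rightarrow> real \<Rightarrow> 'a::metric_space set \<Rightarrow> ennreal" where
  "hausdorff_premeasure s \<delta> E =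
     (INF U \<in> {U :: nat \<Rightarrow> 'a set. E \<subseteq> (\<Union>i. U i) \<and> (\<forall>i. bounded (U i) \<and> diameter (U i) \<le> \<delta>)}.
        \<Sum>i. diam_pow s (U i))"

definition hausdorff_measure :: "real \<Rightarrow> 'a::metric_space set \<Rightarrow> ennreal" where
  "hausdorff_measure s E = (SUP \<delta> \<in> {0<..}. hausdorff_premeasure s \<delta> E)"

definition hausdorff_dim :: "'a::metric_space set \<Rightarrow> ereal" where
  "hausdorff_dim E = Inf {ereal s | s. 0 \<le> s \<and> hausdorff_measure s E = 0}"

text \<open>
  A \<open>\<delta>\<close>-packing of \<open>E\<close>, given by the centres and radii of its balls.
\<close>

definition is_packing :: "real \<Rightarrow> 'a::metric_space set \<Rightarrow> ('a \<times> real) set \<Rightarrow> bool" where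
  "is_packing \<delta> E C \<longleftrightarrow>
     countable C \<and> (\<forall>(x, r) \<in> C. x \<in> E \<and> 0 < r \<and> r \<le> \<delta>) \<and>
     disjoint_family_on (\<lambda>(x, r). cball x r) C"

definition packing_premeasure :: "real \<Rightarrow> 'a::metric_space set \<Rightarrow> ennreal" where
  "packing_premeasure s E =
     (INF \<delta> \<in> {0<..}. SUP C \<in> {C. is_packing \<delta> E C}.
        \<Sum>\<^sub>\<infinity>(x, r) \<in> C. ennreal ((2 * r) powr s))"

text \<open>
  The packing premeasure is not countably subadditive, hence the second infimum
  over countable covers.
\<close>

definition packing_measure :: "real \<Rightarrow> 'a::metric_space set \<Rightarrow> ennreal" where
  "packing_measure s E =
     (INF F \<in> {F :: nat \<Rightarrow> 'a set. E \<subseteq> (\<Union>i. F i)}. \<Sum>i. packing_premeasure s (F i))"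

definition packing_dim :: "'a::metric_space set \<Rightarrow> ereal" where
  "packing_dim E = Inf {ereal s | s. 0 \<le> s \<and> packing_measure s E = 0}"

definition gauss_ints :: "complex set" where
  "gauss_ints = {z. Re z \<in> \<int> \<and> Im z \<in> \<int>}"

definition unit_square :: "complex set" where
  "unit_square = {z. Re z \<in> {-1/2..<1/2} \<and> Im z \<in> {-1/2..<1/2}}"

definition lower_order :: "(real \<Rightarrow> real) \<Rightarrow> ereal" where
  "lower_order \<psi> = Liminf at_top (\<lambda>x::real. ereal (- ln (\<psi> x) / ln x))"

definition approximable_set :: "(real \<Rightarrow> real) \<Rightarrow> complex set" where
  "approximable_set \<psi> =
     {z \<in> unit_square - {0}.
        infinite {(p, q). p \<in> gauss_ints \<and> q \<in> gauss_ints \<and> q \<noteq> 0 \<and>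
                          cmod (z - p / q) \<le> \<psi> (cmod q)}}"

end

theory Submission
  imports Defs
begin

text \<open>
  The upper bound \<open>4 / \<lambda>\<close> is a Borel--Cantelli argument: for \<open>b < \<lambda>\<close>, an approximable point lies
  in infinitely many discs of radius \<open>|q|\<^sup>-\<^sup>b\<close> around fractions \<open>p / q\<close> with \<open>|p| \<le> 2 |q|\<close>, and
  there are \<open>O(R\<^sup>4)\<close> such pairs with \<open>|q| \<le> R\<close>. The upper bound 2 holds for the packing dimension,
  which dominates the Hausdorff dimension.

  For the lower bound, Dirichlet's theorem and an area count show that every disc of radius \<open>r\<close>
  contains, for large \<open>Q\<close>, about \<open>r\<^sup>2 Q\<^sup>4\<close> fractions with denominator at most \<open>Q\<close>, and these are
  \<open>1 / Q\<^sup>2\<close>-separated. If \<open>b > max \<lambda> 2\<close> and \<open>b s < 4\<close>, there are arbitrarily large \<open>Q\<close> for which the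
  discs of radius \<open>Q\<^sup>-\<^sup>b\<close> around these fractions are admissible. Given balls with small
  \<open>\<Sum> \<rho>\<^sub>i\<^sup>s\<close>, averaging over the fractions yields a nested sequence of such discs that
  avoids ever more of the given balls; its limit is an approximable point that they do not cover.

  The approximable points contain a dense \<open>G\<^sub>\<delta>\<close> of a disc. By Baire, one of the sets in any
  countable cover is somewhere dense, and such a set has infinite \<open>s\<close>-dimensional packing premeasure
  for all \<open>s < 2\<close>.
\<close>

subsection \<open>Separated sets and volumes of balls\<close>

definition separated :: "real \<Rightarrow> 'a::metric_space set \<Rightarrow> bool" where
  "separated d A \<longleftrightarrow> pairwise (\<lambda>a b. d \<le> dist a b) A"

lemma separatedD: "separated d A \<Longrightarrow> a \<in> A \<Longrightarrow> b \<in> A \<Longrightarrow> a \<noteq> b \<Longrightarrow> d \<le> dist a b"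
  by (simp add: separated_def pairwise_def)

lemma separated_subset: "separated d A \<Longrightarrow> B \<subseteq> A \<Longrightarrow> separated d B"
  unfolding separated_def by (rule pairwise_subset)

lemma disjoint_balls_if_separated:
  assumes "separated d A"
  shows "disjoint_family_on (\<lambda>a. ball a (d / 2)) A"
  unfolding disjoint_family_on_def
proof (intro ballI impI, rule ccontr)
  fix a b assume ab: "a \<in> A" "b \<in> A" "a \<noteq> b" "ball a (d / 2) \<inter> ball b (d / 2) \<noteq> {}"
  then obtain x where "dist a x < d / 2" "dist b x < d / 2" by auto
  then have "dist a b < d" by (metis dist_triangle_half_l dist_commute)
  with separatedD[OF assms ab(1,2,3)] show False by simp
qed

lemma separated_net_exists:
  assumes "0 < d" and card: "\<And>G. finite G \<Longrightarrow> G \<subseteq> A \<Longrightarrow> separated d G \<Longrightarrow> card G \<le> N"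
  obtains G where "finite G" "G \<subseteq> A" "separated d G" "A \<subseteq> (\<Union>g\<in>G. ball g d)"
proof -
  define P where "P G \<longleftrightarrow> finite G \<and> G \<subseteq> A \<and> separated d G" for G
  have "P {}" by (simp add: P_def separated_def)
  moreover have "\<forall>G. P G \<longrightarrow> card G < Suc N"
    using card by (simp add: P_def less_Suc_eq_le)
  ultimately obtain G where G: "P G" and maximal: "\<forall>H. P H \<longrightarrow> card H \<le> card G"
    using ex_has_greatest_nat[of P "{}" card] by blast
  have "A \<subseteq> (\<Union>g\<in>G. ball g d)"
  proof (rule ccontr)
    assume "\<not> ?thesis"
    then have "\<exists>x\<in>A. \<forall>g\<in>G. d \<le> dist g x" by (simp add: subset_eq not_less)
    then obtain x where x: "x \<in> A" "\<And>g. g \<in> G \<Longrightarrow> d \<le> dist g x" by blast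
    then have "P (insert x G)"
      using G by (auto simp: P_def separated_def pairwise_insert dist_commute)
    with maximal have "card (insert x G) \<le> card G" by blast
    moreover have "x \<notin> G" using x(2)[of x] \<open>0 < d\<close> by auto
    ultimately show False using G by (simp add: P_def)
  qed
  with G show thesis using that unfolding P_def by blast
qed

lemma sum_radius_power_le_of_disjoint:
  fixes c :: "'i \<Rightarrow> 'a::euclidean_space"
  assumes "finite I" "disjoint_family_on (\<lambda>i. ball (c i) (r i)) I"
    and r: "\<And>i. i \<in> I \<Longrightarrow> 0 \<le> r i" and "0 \<le> R"
    and sub: "\<And>i. i \<in> I \<Longrightarrow> ball (c i) (r i) \<subseteq> cball w R"
  shows "(\<Sum>i\<in>I. r i ^ DIM('a)) \<le> R ^ DIM('a)"
proof -
  let ?v = "unit_ball_vol (DIM('a))"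
  have "?v * (\<Sum>i\<in>I. r i ^ DIM('a)) = (\<Sum>i\<in>I. measure lebesgue (ball (c i) (r i)))"
    by (simp add: sum_distrib_left content_ball r)
  also have "\<dots> = measure lebesgue (\<Union>i\<in>I. ball (c i) (r i))"
    using assms by (intro measure_UNION'[symmetric])
      (auto simp: pairwise_def disjoint_family_on_def disjnt_def)
  also have "\<dots> \<le> measure lebesgue (cball w R)"
    using sub by (intro measure_mono_fmeasurable) (auto intro!: sets.finite_UN \<open>finite I\<close>)
  also have "\<dots> = ?v * R ^ DIM('a)"
    using \<open>0 \<le> R\<close> by (simp add: content_cball)
  finally show ?thesis by simp
qed

lemma radius_power_le_of_cover:
  fixes c :: "'i \<Rightarrow> 'a::euclidean_space"
  assumes "finite I" "0 \<le> R" and r: "\<And>i. i \<in> I \<Longrightarrow> 0 \<le> r i"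
    and cover: "cball w R \<subseteq> (\<Union>i\<in>I. cball (c i) (r i))"
  shows "R ^ DIM('a) \<le> (\<Sum>i\<in>I. r i ^ DIM('a))"
proof -
  let ?v = "unit_ball_vol (DIM('a))"
  have "?v * R ^ DIM('a) = measure lebesgue (cball w R)"
    using \<open>0 \<le> R\<close> by (simp add: content_cball)
  also have "\<dots> \<le> measure lebesgue (\<Union>i\<in>I. cball (c i) (r i))"
    using cover \<open>finite I\<close> by (intro measure_mono_fmeasurable fmeasurable.finite_UN) auto
  also have "\<dots> \<le> (\<Sum>i\<in>I. measure lebesgue (cball (c i) (r i)))"
    using \<open>finite I\<close> by (intro measure_UNION_le) auto
  also have "\<dots> = ?v * (\<Sum>i\<in>I. r i ^ DIM('a))"
    by (simp add: sum_distrib_left content_cball r)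
  finally show ?thesis by simp
qed

lemma card_finite_separated_le:
  fixes A :: "'a::euclidean_space set"
  assumes "finite A" "separated d A" "0 < d" "0 \<le> R" "A \<subseteq> cball w R"
  shows "real (card A) \<le> (2 * R / d + 1) ^ DIM('a)"
proof -
  have "(\<Sum>a\<in>A. (d / 2) ^ DIM('a)) \<le> (R + d / 2) ^ DIM('a)"
  proof (rule sum_radius_power_le_of_disjoint)
    show "disjoint_family_on (\<lambda>a. ball a (d / 2)) A"
      using assms(2) by (rule disjoint_balls_if_separated)
    show "ball a (d / 2) \<subseteq> cball w (R + d / 2)" if "a \<in> A" for a
    proof
      fix x assume "x \<in> ball a (d / 2)"
      moreover have "dist w a \<le> R" using \<open>A \<subseteq> cball w R\<close> that by auto
      ultimately show "x \<in> cball w (R + d / 2)"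
        using dist_triangle[of w x a] by simp
    qed
  qed (use assms in auto)
  also have "R + d / 2 = (2 * R / d + 1) * (d / 2)"
    using \<open>0 < d\<close> by (simp add: field_simps)
  finally have "real (card A) * (d / 2) ^ DIM('a) \<le> (2 * R / d + 1) ^ DIM('a) * (d / 2) ^ DIM('a)"
    by (simp only: sum_constant power_mult_distrib)
  then show ?thesis using \<open>0 < d\<close> by simp
qed

lemma
  fixes A :: "'a::euclidean_space set"
  assumes "separated d A" "0 < d" "0 \<le> R" "A \<subseteq> cball w R"
  shows finite_separated: "finite A"
    and card_separated_le: "real (card A) \<le> (2 * R / d + 1) ^ DIM('a)"
proof -
  have "card B \<le> nat \<lceil>(2 * R / d + 1) ^ DIM('a)\<rceil>" if "B \<subseteq> A" "finite B" for B
  proof -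
    have "real (card B) \<le> (2 * R / d + 1) ^ DIM('a)"
      using that assms
      by (intro card_finite_separated_le[of B d R w]) (auto intro: separated_subset)
    then show ?thesis by linarith
  qed
  then show "finite A" using finite_if_finite_subsets_card_bdd by blast
  then show "real (card A) \<le> (2 * R / d + 1) ^ DIM('a)"
    using assms by (intro card_finite_separated_le)
qed

subsection \<open>Hausdorff measure and dimension\<close>

lemma diam_pow_le:
  assumes "bounded U" "diameter U \<le> D" "0 < D" "0 \<le> s"
  shows "diam_pow s U \<le> ennreal (D powr s)"
  using assms diameter_ge_0[OF assms(1)]
  by (auto simp: diam_pow_def intro!: ennreal_leI powr_mono2)

lemma diam_pow_antimono:
  assumes "bounded U" "diameter U \<le> 1" "0 \<le> s" "s \<le> t"
  shows "diam_pow t U \<le> diam_pow s U"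
  using assms diameter_ge_0[OF assms(1)]
  by (auto simp: diam_pow_def intro!: ennreal_leI powr_mono' powr_le1)

lemma hausdorff_premeasure_mono: "E \<subseteq> F \<Longrightarrow> hausdorff_premeasure s \<delta> E \<le> hausdorff_premeasure s \<delta> F"
  unfolding hausdorff_premeasure_def by (rule INF_superset_mono) auto

lemma hausdorff_premeasure_antimono:
  "\<epsilon> \<le> \<delta> \<Longrightarrow> hausdorff_premeasure s \<delta> E \<le> hausdorff_premeasure s \<epsilon> E"
  unfolding hausdorff_premeasure_def by (rule INF_superset_mono) (auto intro: order_trans)

lemma hausdorff_premeasure_le_hausdorff_measure:
  "0 < \<delta> \<Longrightarrow> hausdorff_premeasure s \<delta> E \<le> hausdorff_measure s E"
  unfolding hausdorff_measure_def by (rule SUP_upper) simp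

lemma hausdorff_measure_le:
  "(\<And>\<delta>. 0 < \<delta> \<Longrightarrow> hausdorff_premeasure s \<delta> E \<le> K) \<Longrightarrow> hausdorff_measure s E \<le> K"
  unfolding hausdorff_measure_def by (rule SUP_least) simp

lemma hausdorff_measure_mono: "E \<subseteq> F \<Longrightarrow> hausdorff_measure s E \<le> hausdorff_measure s F"
  unfolding hausdorff_measure_def by (intro SUP_mono' hausdorff_premeasure_mono)

lemma hausdorff_measure_antimono:
  assumes "0 \<le> s" "s \<le> t"
  shows "hausdorff_measure t E \<le> hausdorff_measure s E"
proof (rule hausdorff_measure_le)
  fix \<delta> :: real assume "0 < \<delta>"
  have "hausdorff_premeasure t \<delta> E \<le> hausdorff_premeasure t (min \<delta> 1) E"
    by (rule hausdorff_premeasure_antimono) simp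
  also have "\<dots> \<le> hausdorff_premeasure s (min \<delta> 1) E"
    unfolding hausdorff_premeasure_def using assms
    by (intro INF_superset_mono suminf_le diam_pow_antimono) auto
  also have "\<dots> \<le> hausdorff_measure s E"
    using \<open>0 < \<delta>\<close> by (intro hausdorff_premeasure_le_hausdorff_measure) simp
  finally show "hausdorff_premeasure t \<delta> E \<le> hausdorff_measure s E" .
qed

lemma hausdorff_premeasure_le_countable_cover:
  fixes U :: "'i \<Rightarrow> 'a::metric_space set"
  assumes "countable I" "E \<subseteq> (\<Union>i\<in>I. U i)"
    and U: "\<And>i. i \<in> I \<Longrightarrow> bounded (U i)" "\<And>i. i \<in> I \<Longrightarrow> diameter (U i) \<le> \<delta>" and "0 \<le> \<delta>"
    and sum: "\<And>F. finite F \<Longrightarrow> F \<subseteq> I \<Longrightarrow> (\<Sum>i\<in>F. diam_pow s (U i)) \<le> K"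
  shows "hausdorff_premeasure s \<delta> E \<le> K"
proof -
  define V where "V n = (\<Union>i\<in>{i \<in> I. to_nat_on I i = n}. U i)" for n
  have V_to_nat: "V (to_nat_on I i) = U i" if "i \<in> I" for i
    using inj_on_to_nat_on[OF \<open>countable I\<close>] that by (auto simp: V_def inj_on_def)
  have V_empty: "V n = {}" if "n \<notin> to_nat_on I ` I" for n
    using that by (auto simp: V_def)
  have "E \<subseteq> (\<Union>n. V n)"
    using \<open>E \<subseteq> (\<Union>i\<in>I. U i)\<close> V_to_nat by blast
  moreover have "bounded (V n) \<and> diameter (V n) \<le> \<delta>" for n
    using V_to_nat V_empty U \<open>0 \<le> \<delta>\<close> by (cases "n \<in> to_nat_on I ` I") auto
  ultimately have "hausdorff_premeasure s \<delta> E \<le> (\<Sum>n. diam_pow s (V n))"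
    unfolding hausdorff_premeasure_def by (intro INF_lower) auto
  also have "\<dots> \<le> K"
  proof (rule suminf_le_const[OF summableI])
    fix N
    define F where "F = {i \<in> I. to_nat_on I i < N}"
    have inj: "inj_on (to_nat_on I) F"
      using inj_on_to_nat_on[OF \<open>countable I\<close>] by (rule inj_on_subset) (auto simp: F_def)
    have "finite F"
      using inj by (rule inj_on_finite[where B = "{..<N}"]) (auto simp: F_def)
    have "(\<Sum>n<N. diam_pow s (V n)) = (\<Sum>n\<in>to_nat_on I ` F. diam_pow s (V n))"
      by (intro sum.mono_neutral_right) (auto simp: F_def V_empty diam_pow_def image_iff V_def)
    also have "\<dots> = (\<Sum>i\<in>F. diam_pow s (U i))"
      unfolding sum.reindex[OF inj] by (intro sum.cong) (auto simp: F_def V_to_nat)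
    also have "\<dots> \<le> K"
      using \<open>finite F\<close> by (rule sum) (auto simp: F_def)
    finally show "(\<Sum>n<N. diam_pow s (V n)) \<le> K" .
  qed
  finally show ?thesis .
qed

lemma hausdorff_premeasure_UN_le:
  fixes E :: "nat \<Rightarrow> 'a::metric_space set"
  shows "hausdorff_premeasure s \<delta> (\<Union>i. E i) \<le> (\<Sum>i. hausdorff_premeasure s \<delta> (E i))"
proof (rule ennreal_le_epsilon)
  fix e :: real assume "0 < e" and fin: "(\<Sum>i. hausdorff_premeasure s \<delta> (E i)) < top"
  define \<epsilon> where "\<epsilon> i = e * (1 / 2) ^ Suc i" for i
  have "0 < \<epsilon> i" for i using \<open>0 < e\<close> by (simp add: \<epsilon>_def)
  have "\<exists>U. E i \<subseteq> (\<Union>j. U j) \<and> (\<forall>j. bounded (U j) \<and> diameter (U j) \<le> \<delta>) \<and>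
      (\<Sum>j. diam_pow s (U j)) < hausdorff_premeasure s \<delta> (E i) + \<epsilon> i" for i
    using INF_approx_ennreal[OF \<open>0 < \<epsilon> i\<close> hausdorff_premeasure_def[of s \<delta> "E i"]]
      ennreal_suminf_lessD[OF fin, of i] by auto
  then obtain U where cover: "\<And>i. E i \<subseteq> (\<Union>j. U i j)"
    and U: "\<And>i j. bounded (U i j)" "\<And>i j. diameter (U i j) \<le> \<delta>"
    and approx: "\<And>i. (\<Sum>j. diam_pow s (U i j)) < hausdorff_premeasure s \<delta> (E i) + \<epsilon> i"
    by metis
  have "(\<Union>i. E i) \<subseteq> (\<Union>n. case_prod U (prod_decode n))"
  proof
    fix x assume "x \<in> (\<Union>i. E i)"
    then obtain i j where "x \<in> U i j" using cover by blast
    then have "x \<in> case_prod U (prod_decode (prod_encode (i, j)))" by simp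
    then show "x \<in> (\<Union>n. case_prod U (prod_decode n))" by (rule UN_I[OF UNIV_I])
  qed
  then have "hausdorff_premeasure s \<delta> (\<Union>i. E i) \<le> (\<Sum>n. diam_pow s (case_prod U (prod_decode n)))"
    unfolding hausdorff_premeasure_def using U by (intro INF_lower) (auto simp: split_beta)
  also have "\<dots> = (\<Sum>i. \<Sum>j. diam_pow s (U i j))"
    by (rule suminf_ennreal_2dimen) simp
  also have "\<dots> \<le> (\<Sum>i. hausdorff_premeasure s \<delta> (E i) + ennreal (\<epsilon> i))"
    by (intro suminf_le less_imp_le approx) auto
  also have "\<dots> = (\<Sum>i. hausdorff_premeasure s \<delta> (E i)) + (\<Sum>i. ennreal (\<epsilon> i))"
    by (rule suminf_add[symmetric]) auto
  also have "(\<Sum>i. ennreal (\<epsilon> i)) = ennreal e"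
  proof (rule suminf_ennreal_eq)
    show "\<epsilon> sums e"
      using sums_mult[OF power_half_series, of e] by (simp add: \<epsilon>_def[abs_def])
  qed (use \<open>\<And>i. 0 < \<epsilon> i\<close> in \<open>simp add: less_imp_le\<close>)
  finally show "hausdorff_premeasure s \<delta> (\<Union>i. E i)
      \<le> (\<Sum>i. hausdorff_premeasure s \<delta> (E i)) + ennreal e" .
qed

lemma summable_on_sum_tail_less:
  fixes f :: "'i \<Rightarrow> real"
  assumes "f summable_on I" "\<And>i. i \<in> I \<Longrightarrow> 0 \<le> f i" "0 < e"
  obtains F where "finite F" "\<And>G. finite G \<Longrightarrow> G \<subseteq> I - F \<Longrightarrow> sum f G < e"
proof -
  have "(sum f \<longlongrightarrow> infsum f I) (finite_subsets_at_top I)"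
    using has_sum_infsum[OF assms(1)] by (simp add: has_sum_def)
  then have "\<forall>\<^sub>F F in finite_subsets_at_top I. infsum f I - e < sum f F"
    using \<open>0 < e\<close> by (intro order_tendstoD) auto
  then obtain F where F: "finite F" "F \<subseteq> I" "infsum f I - e < sum f F"
    unfolding eventually_finite_subsets_at_top by blast
  have "sum f G < e" if G: "finite G" "G \<subseteq> I - F" for G
  proof -
    have "sum f F + sum f G = sum f (F \<union> G)"
      using F G by (intro sum.union_disjoint[symmetric]) auto
    also have "\<dots> \<le> infsum f I"
      using F G assms by (intro finite_sum_le_infsum) auto
    finally show ?thesis using F(3) by simp
  qed
  with F that show thesis by blast
qed

lemma hausdorff_premeasure_le_if_sum_diameter_powr_less:
  fixes U :: "'i \<Rightarrow> 'a::metric_space set"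
  assumes "countable I" "E \<subseteq> (\<Union>i\<in>I. U i)" "\<And>i. i \<in> I \<Longrightarrow> bounded (U i)"
    and "0 < s" "0 \<le> \<delta>" "e \<le> \<delta> powr s"
    and sum: "\<And>F. finite F \<Longrightarrow> F \<subseteq> I \<Longrightarrow> (\<Sum>i\<in>F. diameter (U i) powr s) < e"
  shows "hausdorff_premeasure s \<delta> E \<le> ennreal e"
proof (rule hausdorff_premeasure_le_countable_cover[OF assms(1,2)])
  show "diameter (U i) \<le> \<delta>" if "i \<in> I" for i
  proof (rule ccontr)
    assume "\<not> diameter (U i) \<le> \<delta>"
    then have "\<delta> powr s \<le> diameter (U i) powr s"
      using \<open>0 \<le> \<delta>\<close> \<open>0 < s\<close> by (intro powr_mono2) auto
    with sum[of "{i}"] \<open>e \<le> \<delta> powr s\<close> that show False by simp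
  qed
  show "(\<Sum>i\<in>F. diam_pow s (U i)) \<le> ennreal e" if F: "finite F" "F \<subseteq> I" for F
  proof -
    have "(\<Sum>i\<in>F. diam_pow s (U i)) \<le> (\<Sum>i\<in>F. ennreal (diameter (U i) powr s))"
      using \<open>0 < s\<close> by (intro sum_mono) (simp add: diam_pow_def)
    also have "\<dots> = ennreal (\<Sum>i\<in>F. diameter (U i) powr s)"
      by (rule sum_ennreal) simp
    also have "\<dots> \<le> ennreal e" using sum[OF F] by (intro ennreal_leI) simp
    finally show ?thesis .
  qed
qed (use assms in auto)

lemma hausdorff_cantelli:
  fixes U :: "'i \<Rightarrow> 'a::metric_space set"
  assumes "countable I" "0 < s" and bounded: "\<And>i. i \<in> I \<Longrightarrow> bounded (U i)"
    and summable: "(\<lambda>i. diameter (U i) powr s) summable_on I"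
    and limsup: "\<And>z. z \<in> E \<Longrightarrow> infinite {i \<in> I. z \<in> U i}"
  shows "hausdorff_measure s E = 0"
proof -
  have premeasure_le: "hausdorff_premeasure s \<delta> E \<le> ennreal e" if "0 < \<delta>" "0 < e" for \<delta> e
  proof -
    have "0 < min e (\<delta> powr s)" using that by simp
    then obtain F where "finite F" and tail: "\<And>G. finite G \<Longrightarrow> G \<subseteq> I - F \<Longrightarrow>
        (\<Sum>i\<in>G. diameter (U i) powr s) < min e (\<delta> powr s)"
      by (rule summable_on_sum_tail_less[OF summable powr_ge_zero]) (rule that)
    have "E \<subseteq> (\<Union>i\<in>I - F. U i)"
    proof
      fix z assume "z \<in> E"
      then have "\<not> {i \<in> I. z \<in> U i} \<subseteq> F"
        using limsup \<open>finite F\<close> finite_subset by blast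
      then show "z \<in> (\<Union>i\<in>I - F. U i)" by blast
    qed
    then have "hausdorff_premeasure s \<delta> E \<le> ennreal (min e (\<delta> powr s))"
      using assms(1,2) bounded tail \<open>0 < \<delta>\<close>
      by (intro hausdorff_premeasure_le_if_sum_diameter_powr_less[where I = "I - F" and U = U]) auto
    also have "\<dots> \<le> ennreal e" by (rule ennreal_leI) simp
    finally show ?thesis .
  qed
  have "hausdorff_premeasure s \<delta> E \<le> 0" if "0 < \<delta>" for \<delta>
    by (rule ennreal_le_epsilon) (simp add: premeasure_le that)
  then have "hausdorff_measure s E \<le> 0" by (rule hausdorff_measure_le)
  then show ?thesis by simp
qed

lemma hausdorff_measure_eq_0_imp_small_cover:
  assumes null: "hausdorff_measure s E = 0" and "0 < s" "0 < \<eta>"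
  obtains U :: "nat \<Rightarrow> 'a::metric_space set" where "E \<subseteq> (\<Union>i. U i)" "\<And>i. bounded (U i)"
    "summable (\<lambda>i. diameter (U i) powr s)" "(\<Sum>i. diameter (U i) powr s) < \<eta>"
proof -
  have "hausdorff_premeasure s 1 E < ennreal \<eta>"
    using hausdorff_premeasure_le_hausdorff_measure[of 1 s E] null \<open>0 < \<eta>\<close> by simp
  then obtain U where U: "E \<subseteq> (\<Union>i. U i)" "\<And>i. bounded (U i)"
    and less: "(\<Sum>i. diam_pow s (U i)) < ennreal \<eta>"
    unfolding hausdorff_premeasure_def INF_less_iff by blast
  define a where "a i = diameter (U i) powr s" for i
  have a_nonneg: "0 \<le> a i" for i by (simp add: a_def)
  have "(\<Sum>i. ennreal (a i)) \<le> (\<Sum>i. diam_pow s (U i))"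
    using \<open>0 < s\<close> by (intro suminf_le) (auto simp: a_def diam_pow_def)
  with less have a_less: "(\<Sum>i. ennreal (a i)) < ennreal \<eta>" by simp
  then have "summable a"
    using a_nonneg by (intro summable_suminf_not_top) auto
  with a_less have "suminf a < \<eta>"
    using a_nonneg suminf_nonneg[of a] by (simp add: suminf_ennreal2 ennreal_less_iff)
  with U \<open>summable a\<close> show thesis by (intro that[of U]) (auto simp: a_def[abs_def])
qed

lemma hausdorff_measure_eq_0_imp_small_cball_cover:
  fixes E :: "'a::metric_space set"
  assumes "hausdorff_measure s E = 0" "0 < s" "0 < \<eta>"
  obtains x :: "nat \<Rightarrow> 'a" and \<rho> :: "nat \<Rightarrow> real"
  where "E \<subseteq> (\<Union>i. cball (x i) (\<rho> i))" "\<And>i. 0 < \<rho> i"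
    "summable (\<lambda>i. \<rho> i powr s)" "(\<Sum>i. \<rho> i powr s) < \<eta>"
proof -
  have "0 < \<eta> / 2" using \<open>0 < \<eta>\<close> by simp
  from hausdorff_measure_eq_0_imp_small_cover[OF assms(1,2) this]
  obtain U where U: "E \<subseteq> (\<Union>i. U i)" "\<And>i. bounded (U i)"
    and summable_diameter: "summable (\<lambda>i. diameter (U i) powr s)"
    and sum_diameter: "(\<Sum>i. diameter (U i) powr s) < \<eta> / 2" by blast
  \<comment> \<open>Sets of diameter 0 have to be enlarged, since the balls must have positive radius.\<close>
  define \<epsilon> where "\<epsilon> i = \<eta> / 2 * (1 / 2) ^ Suc i" for i
  have "\<epsilon> sums (\<eta> / 2)"
    using sums_mult[OF power_half_series, of "\<eta> / 2"] by (simp add: \<epsilon>_def[abs_def])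
  define \<rho> where "\<rho> i = max (diameter (U i)) (\<epsilon> i powr (1 / s))" for i
  have \<rho>_pos: "0 < \<rho> i" for i
    using \<open>0 < \<eta>\<close> by (simp add: \<rho>_def \<epsilon>_def less_max_iff_disj)
  have \<rho>_le: "\<rho> i powr s \<le> diameter (U i) powr s + \<epsilon> i" for i
    using \<open>0 < \<eta>\<close> \<open>0 < s\<close> by (auto simp: \<rho>_def \<epsilon>_def max_def powr_powr)
  have sums: "(\<lambda>i. diameter (U i) powr s + \<epsilon> i) sums ((\<Sum>i. diameter (U i) powr s) + \<eta> / 2)"
    using summable_diameter \<open>\<epsilon> sums (\<eta> / 2)\<close> by (intro sums_add summable_sums)
  have summable: "summable (\<lambda>i. \<rho> i powr s)"
    by (rule summable_comparison_test'[OF sums_summable[OF sums]]) (simp add: \<rho>_le)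
  have "(\<Sum>i. \<rho> i powr s) \<le> (\<Sum>i. diameter (U i) powr s) + \<eta> / 2"
    using sums_le[OF \<rho>_le summable_sums[OF summable] sums] .
  also have "\<dots> < \<eta>" using sum_diameter by simp
  finally have sum_less: "(\<Sum>i. \<rho> i powr s) < \<eta>" .
  define x where "x i = (SOME y. y \<in> U i)" for i
  have "U i \<subseteq> cball (x i) (\<rho> i)" for i
  proof
    fix y assume y: "y \<in> U i"
    then have "x i \<in> U i" unfolding x_def by (rule someI)
    then have "dist (x i) y \<le> diameter (U i)"
      using y U(2) by (intro diameter_bounded_bound)
    then show "y \<in> cball (x i) (\<rho> i)" by (simp add: \<rho>_def)
  qed
  then have "(\<Union>i. U i) \<subseteq> (\<Union>i. cball (x i) (\<rho> i))" by (rule UN_mono[OF order_refl])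
  with U(1) have "E \<subseteq> (\<Union>i. cball (x i) (\<rho> i))" by (rule order_trans)
  then show thesis using \<rho>_pos summable sum_less by (rule that)
qed

lemma hausdorff_dim_le: "0 \<le> s \<Longrightarrow> hausdorff_measure s E = 0 \<Longrightarrow> hausdorff_dim E \<le> ereal s"
  unfolding hausdorff_dim_def by (rule Inf_lower) blast

lemma le_hausdorff_dim:
  assumes "hausdorff_measure s E \<noteq> 0"
  shows "ereal s \<le> hausdorff_dim E"
  unfolding hausdorff_dim_def
proof (rule Inf_greatest)
  fix y assume "y \<in> {ereal u | u. 0 \<le> u \<and> hausdorff_measure u E = 0}"
  then obtain u where u: "y = ereal u" "0 \<le> u" "hausdorff_measure u E = 0" by blast
  then have "\<not> u \<le> s" using hausdorff_measure_antimono[of u s E] assms by auto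
  then show "ereal s \<le> y" by (simp add: u)
qed

lemma diameter_ball_le:
  fixes x :: "'a::metric_space"
  assumes "0 < r"
  shows "diameter (ball x r) \<le> 2 * r"
proof -
  have "dist y z \<le> 2 * r" if "y \<in> ball x r" "z \<in> ball x r" for y z
    using that dist_triangle3[of y z x] by simp
  then show ?thesis using assms by (auto simp: diameter_def intro!: cSUP_least)
qed

lemma ennreal_le_mult_INF:
  fixes x :: ennreal
  assumes "0 < c" "c < \<infinity>" "\<And>i. i \<in> I \<Longrightarrow> x \<le> c * f i"
  shows "x \<le> c * (INF i\<in>I. f i)"
proof -
  have "x = c * (x / c)"
    using assms by (simp add: ennreal_times_divide mult.commute[of c] mult_divide_eq_ennreal)
  also have "\<dots> \<le> c * (INF i\<in>I. f i)"
    using assms by (intro mult_left_mono INF_greatest divide_le_posI_ennreal) auto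
  finally show ?thesis .
qed

subsection \<open>Packing measure and dimension\<close>

definition packing_content :: "real \<Rightarrow> real \<Rightarrow> 'a::metric_space set \<Rightarrow> ennreal" where
  "packing_content s \<delta> E =
     (SUP C \<in> {C. is_packing \<delta> E C}. \<Sum>\<^sub>\<infinity>(x, r) \<in> C. ennreal ((2 * r) powr s))"

lemma packing_premeasure_altdef: "packing_premeasure s E = (INF \<delta> \<in> {0<..}. packing_content s \<delta> E)"
  by (simp add: packing_premeasure_def packing_content_def)

lemma is_packing_mono: "is_packing \<epsilon> E C \<Longrightarrow> \<epsilon> \<le> \<delta> \<Longrightarrow> is_packing \<delta> E C"
  by (fastforce simp: is_packing_def)

lemma packing_content_mono: "\<epsilon> \<le> \<delta> \<Longrightarrow> packing_content s \<epsilon> E \<le> packing_content s \<delta> E"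
  unfolding packing_content_def by (rule SUP_subset_mono) (auto intro: is_packing_mono)

lemma packing_measure_mono: "E \<subseteq> F \<Longrightarrow> packing_measure s E \<le> packing_measure s F"
  unfolding packing_measure_def by (rule INF_superset_mono) auto

lemma packing_dim_mono:
  assumes "E \<subseteq> F"
  shows "packing_dim E \<le> packing_dim F"
  unfolding packing_dim_def
proof (rule Inf_superset_mono, clarify)
  fix s :: real assume "0 \<le> s" "packing_measure s F = 0"
  then show "\<exists>u. ereal s = ereal u \<and> 0 \<le> u \<and> packing_measure u E = 0"
    using packing_measure_mono[OF assms, of s] by auto
qed

lemma card_separated_le_packing_content:
  assumes "finite G" "G \<subseteq> E" "separated d G" "2 * r < d" "0 < r" "r \<le> \<delta>"
  shows "ennreal (real (card G) * (2 * r) powr s) \<le> packing_content s \<delta> E"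
proof -
  let ?C = "(\<lambda>g. (g, r)) ` G"
  have "disjoint_family_on (\<lambda>g. cball g r) G"
  proof (rule disjoint_family_on_bisimulation[OF disjoint_balls_if_separated[OF \<open>separated d G\<close>]])
    have "cball g r \<subseteq> ball g (d / 2)" for g :: 'a using \<open>2 * r < d\<close> by auto
    then show "cball g r \<inter> cball h r = {}" if "ball g (d / 2) \<inter> ball h (d / 2) = {}" for g h :: 'a
      using that by blast
  qed
  then have "is_packing \<delta> E ?C"
    using assms by (auto simp: is_packing_def countable_finite disjoint_family_on_def)
  moreover have "(\<Sum>\<^sub>\<infinity>(x, r)\<in>?C. ennreal ((2 * r) powr s))
      = ennreal (real (card G) * (2 * r) powr s)"
    using \<open>finite G\<close>
    by (simp add: sum.reindex inj_on_def ennreal_mult ennreal_of_nat_eq_real_of_nat)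
  ultimately show ?thesis
    unfolding packing_content_def by (metis (mono_tags, lifting) SUP_upper mem_Collect_eq)
qed

lemma packing_content_net_exists:
  assumes "0 < r" and finite: "packing_content s r E < \<infinity>"
  obtains G where "finite G" "E \<subseteq> (\<Union>g\<in>G. ball g (3 * r))"
    "ennreal (real (card G) * (2 * r) powr s) \<le> packing_content s r E"
proof -
  have content: "ennreal (real (card G) * (2 * r) powr s) \<le> packing_content s r E"
    if "finite G" "G \<subseteq> E" "separated (3 * r) G" for G
    using that \<open>0 < r\<close> by (intro card_separated_le_packing_content) auto
  obtain K where K: "packing_content s r E = ennreal K" "0 \<le> K"
    using finite by (cases "packing_content s r E") auto
  define N where "N = nat \<lceil>K / (2 * r) powr s\<rceil>"
  have card_le: "card G \<le> N" if "finite G" "G \<subseteq> E" "separated (3 * r) G" for G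
  proof -
    have "real (card G) * (2 * r) powr s \<le> K"
      using content[OF that] K by (simp add: ennreal_le_iff)
    then have "real (card G) \<le> K / (2 * r) powr s"
      using \<open>0 < r\<close> by (simp add: field_simps)
    then show ?thesis unfolding N_def by linarith
  qed
  have "0 < 3 * r" using \<open>0 < r\<close> by simp
  then obtain G where G: "finite G" "G \<subseteq> E" "separated (3 * r) G" "E \<subseteq> (\<Union>g\<in>G. ball g (3 * r))"
    using separated_net_exists[of "3 * r" E N] card_le by metis
  then show thesis using that content by blast
qed

lemma hausdorff_premeasure_le_packing_content:
  assumes "0 \<le> s" "0 < r"
  shows "hausdorff_premeasure s (6 * r) E \<le> ennreal (3 powr s) * packing_content s r E"
proof (cases "packing_content s r E < \<infinity>")
  case True
  with \<open>0 < r\<close> obtain G where G: "finite G" "E \<subseteq> (\<Union>g\<in>G. ball g (3 * r))"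
      "ennreal (real (card G) * (2 * r) powr s) \<le> packing_content s r E"
    by (rule packing_content_net_exists)
  have "hausdorff_premeasure s (6 * r) E
      \<le> ennreal (3 powr s) * ennreal (real (card G) * (2 * r) powr s)"
  proof (rule hausdorff_premeasure_le_countable_cover[OF _ G(2)])
    fix F assume F: "finite F" "F \<subseteq> G"
    have "(\<Sum>g\<in>F. diam_pow s (ball g (3 * r))) \<le> (\<Sum>g\<in>F. ennreal ((6 * r) powr s))"
      using assms by (intro sum_mono diam_pow_le) (auto intro: order_trans[OF diameter_ball_le])
    also have "\<dots> = ennreal (real (card F) * (6 * r) powr s)"
      by (simp add: ennreal_mult ennreal_of_nat_eq_real_of_nat)
    also have "\<dots> \<le> ennreal (real (card G) * (6 * r) powr s)"
      using F G(1) by (intro ennreal_leI mult_right_mono) (auto intro: card_mono)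
    also have "real (card G) * (6 * r) powr s = 3 powr s * (real (card G) * (2 * r) powr s)"
      using powr_mult[of 3 "2 * r" s] by simp
    finally show "(\<Sum>g\<in>F. diam_pow s (ball g (3 * r)))
        \<le> ennreal (3 powr s) * ennreal (real (card G) * (2 * r) powr s)"
      by (simp add: ennreal_mult)
  qed (use G(1) \<open>0 < r\<close> in \<open>auto simp: countable_finite intro: order_trans[OF diameter_ball_le]\<close>)
  also have "\<dots> \<le> ennreal (3 powr s) * packing_content s r E"
    using G(3) by (rule mult_left_mono) simp
  finally show ?thesis .
qed (simp add: not_less top_unique ennreal_mult_top)

lemma hausdorff_premeasure_le_packing_premeasure:
  assumes "0 \<le> s" "0 < \<delta>"
  shows "hausdorff_premeasure s \<delta> E \<le> ennreal (3 powr s) * packing_premeasure s E"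
proof -
  have "hausdorff_premeasure s \<delta> E \<le> ennreal (3 powr s) * packing_content s r E" if "0 < r" for r
  proof -
    have "hausdorff_premeasure s \<delta> E \<le> hausdorff_premeasure s (6 * min r (\<delta> / 6)) E"
      by (rule hausdorff_premeasure_antimono) simp
    also have "\<dots> \<le> ennreal (3 powr s) * packing_content s (min r (\<delta> / 6)) E"
      using that assms by (intro hausdorff_premeasure_le_packing_content) auto
    also have "\<dots> \<le> ennreal (3 powr s) * packing_content s r E"
      by (intro mult_left_mono packing_content_mono) auto
    finally show ?thesis .
  qed
  then show ?thesis
    unfolding packing_premeasure_altdef by (intro ennreal_le_mult_INF) auto
qed

lemma hausdorff_measure_le_packing_measure:
  assumes "0 \<le> s"
  shows "hausdorff_measure s E \<le> ennreal (3 powr s) * packing_measure s E"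
proof (rule hausdorff_measure_le)
  fix \<delta> :: real assume "0 < \<delta>"
  have "hausdorff_premeasure s \<delta> E \<le> ennreal (3 powr s) * (\<Sum>i. packing_premeasure s (F i))"
    if "E \<subseteq> (\<Union>i. F i)" for F :: "nat \<Rightarrow> 'a set"
  proof -
    have "hausdorff_premeasure s \<delta> E \<le> (\<Sum>i. hausdorff_premeasure s \<delta> (F i))"
      using hausdorff_premeasure_mono[OF that] hausdorff_premeasure_UN_le by (rule order_trans)
    also have "\<dots> \<le> (\<Sum>i. ennreal (3 powr s) * packing_premeasure s (F i))"
      using assms \<open>0 < \<delta>\<close> by (intro suminf_le hausdorff_premeasure_le_packing_premeasure) auto
    finally show ?thesis by simp
  qed
  then show "hausdorff_premeasure s \<delta> E \<le> ennreal (3 powr s) * packing_measure s E"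
    unfolding packing_measure_def by (intro ennreal_le_mult_INF) auto
qed

lemma hausdorff_dim_le_packing_dim: "hausdorff_dim E \<le> packing_dim E"
  unfolding packing_dim_def
proof (rule Inf_greatest)
  fix y assume "y \<in> {ereal s | s. 0 \<le> s \<and> packing_measure s E = 0}"
  then obtain s where s: "y = ereal s" "0 \<le> s" "packing_measure s E = 0" by blast
  then have "hausdorff_measure s E = 0"
    using hausdorff_measure_le_packing_measure[of s E] by simp
  then show "hausdorff_dim E \<le> y" using s hausdorff_dim_le by simp
qed

lemma sum_packing_radius_power_le:
  fixes E :: "'a::euclidean_space set"
  assumes F: "is_packing \<delta> E F" "finite F" and E: "E \<subseteq> cball w R" "0 \<le> R" and "0 < \<delta>"
  shows "(\<Sum>i\<in>F. snd i ^ DIM('a)) \<le> (R + \<delta>) ^ DIM('a)"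
proof (rule sum_radius_power_le_of_disjoint)
  have centre_in_E: "fst i \<in> E" and radius: "0 < snd i" "snd i \<le> \<delta>" if "i \<in> F" for i
    using F(1) that by (auto simp: is_packing_def split_beta)
  have "disjoint_family_on (\<lambda>(x, r). cball x r) F"
    using F(1) by (simp add: is_packing_def)
  then show "disjoint_family_on (\<lambda>i. ball (fst i) (snd i)) F"
    by (rule disjoint_family_on_bisimulation)
      (use ball_subset_cball in \<open>fastforce simp: split_beta\<close>)
  show "ball (fst i) (snd i) \<subseteq> cball w (R + \<delta>)" if "i \<in> F" for i
  proof
    fix z assume "z \<in> ball (fst i) (snd i)"
    moreover have "dist w (fst i) \<le> R" using centre_in_E[OF that] E by auto
    ultimately show "z \<in> cball w (R + \<delta>)"
      using radius(2)[OF that] dist_triangle[of w z "fst i"] by simp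
  qed
  show "0 \<le> snd i" if "i \<in> F" for i using radius(1)[OF that] by simp
qed (use assms in auto)

lemma packing_content_le_of_bounded:
  fixes E :: "'a::euclidean_space set" and s :: real
  assumes E: "E \<subseteq> cball w R" "0 \<le> R" and "DIM('a) \<le> s" "0 < \<delta>"
  shows "packing_content s \<delta> E \<le> ennreal ((2 * \<delta>) powr (s - DIM('a)) * (2 * (R + \<delta>)) ^ DIM('a))"
proof -
  let ?n = "DIM('a)"
  let ?K = "(2 * \<delta>) powr (s - ?n) * (2 * (R + \<delta>)) ^ ?n"
  have term_le: "(2 * r) powr s \<le> (2 * \<delta>) powr (s - ?n) * (2 ^ ?n * r ^ ?n)"
    if "0 < r" "r \<le> \<delta>" for r
  proof -
    have "(2 * r) powr s = (2 * r) powr (s - ?n) * (2 * r) powr ?n"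
      by (simp add: powr_add[symmetric])
    also have "\<dots> \<le> (2 * \<delta>) powr (s - ?n) * (2 * r) powr ?n"
      using that assms by (intro mult_right_mono powr_mono2) auto
    finally show ?thesis using that by (simp add: powr_realpow power_mult_distrib)
  qed
  have "(\<Sum>(x, r)\<in>F. ennreal ((2 * r) powr s)) \<le> ennreal ?K"
    if C: "is_packing \<delta> E C" and F: "finite F" "F \<subseteq> C" for C F
  proof -
    have packing: "is_packing \<delta> E F"
      using C F by (auto simp: is_packing_def countable_finite intro: disjoint_family_on_mono)
    then have radius: "0 < snd i" "snd i \<le> \<delta>" if "i \<in> F" for i
      using that by (auto simp: is_packing_def split_beta)
    have "(\<Sum>(x, r)\<in>F. ennreal ((2 * r) powr s)) = ennreal (\<Sum>i\<in>F. (2 * snd i) powr s)"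
      by (simp add: split_beta sum_ennreal)
    also have "(\<Sum>i\<in>F. (2 * snd i) powr s) \<le> (\<Sum>i\<in>F. (2 * \<delta>) powr (s - ?n) * (2 ^ ?n * snd i ^ ?n))"
      using radius by (intro sum_mono term_le)
    also have "\<dots> = (2 * \<delta>) powr (s - ?n) * 2 ^ ?n * (\<Sum>i\<in>F. snd i ^ ?n)"
      by (simp add: sum_distrib_left mult.assoc)
    also have "\<dots> \<le> (2 * \<delta>) powr (s - ?n) * 2 ^ ?n * (R + \<delta>) ^ ?n"
      using packing F(1) E \<open>0 < \<delta>\<close> by (intro mult_left_mono sum_packing_radius_power_le) auto
    also have "\<dots> = ?K" by (simp only: power_mult_distrib mult.assoc)
    finally show ?thesis by (simp add: ennreal_leI)
  qed
  then show ?thesis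
    unfolding packing_content_def
    by (intro SUP_least) (subst nonneg_infsum_complete, auto intro!: SUP_least)
qed

lemma packing_premeasure_bounded_eq_0:
  fixes E :: "'a::euclidean_space set" and s :: real
  assumes "bounded E" "DIM('a) < s"
  shows "packing_premeasure s E = 0"
proof -
  obtain R where R: "E \<subseteq> cball 0 R" "0 \<le> R"
    using \<open>bounded E\<close> unfolding bounded_pos by (metis mem_cball_0 less_imp_le subsetI)
  define K where "K \<delta> = (2 * \<delta>) powr (s - DIM('a)) * (2 * (R + \<delta>)) ^ DIM('a)" for \<delta>
  have "(K \<longlongrightarrow> (2 * 0) powr (s - DIM('a)) * (2 * (R + 0)) ^ DIM('a)) (at_right 0)"
    unfolding K_def using assms
    by (intro tendsto_intros) (auto intro!: eventually_at_rightI[of 0 1])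
  then have "(K \<longlongrightarrow> 0) (at_right 0)" by simp
  have small: "packing_premeasure s E \<le> ennreal e" if "0 < e" for e
  proof -
    have "\<forall>\<^sub>F \<delta> in at_right 0. K \<delta> < e \<and> 0 < \<delta>"
      using order_tendstoD(2)[OF \<open>(K \<longlongrightarrow> 0) (at_right 0)\<close> that] eventually_at_right_less
      by (rule eventually_conj)
    then obtain \<delta> where \<delta>: "K \<delta> < e" "0 < \<delta>"
      using eventually_happens trivial_limit_at_right_real by blast
    have "packing_premeasure s E \<le> packing_content s \<delta> E"
      unfolding packing_premeasure_altdef using \<open>0 < \<delta>\<close> by (intro INF_lower) simp
    also have "\<dots> \<le> ennreal (K \<delta>)"
      unfolding K_def using R assms \<open>0 < \<delta>\<close> by (intro packing_content_le_of_bounded) auto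
    also have "\<dots> \<le> ennreal e" using \<delta> by (intro ennreal_leI) simp
    finally show ?thesis .
  qed
  have "packing_premeasure s E \<le> 0" by (rule ennreal_le_epsilon) (simp add: small)
  then show ?thesis by simp
qed

lemma packing_measure_eq_0:
  fixes E :: "'a::euclidean_space set" and s :: real
  assumes "DIM('a) < s"
  shows "packing_measure s E = 0"
proof -
  let ?F = "\<lambda>i. E \<inter> cball 0 (real i)"
  have "E \<subseteq> (\<Union>i. ?F i)" using real_arch_simple by auto
  then have "packing_measure s E \<le> (\<Sum>i. packing_premeasure s (?F i))"
    unfolding packing_measure_def by (intro INF_lower) simp
  also have "\<dots> = 0" using assms by (simp add: packing_premeasure_bounded_eq_0 bounded_Int)
  finally show ?thesis by simp
qed

lemma packing_dim_le_DIM: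
  fixes E :: "'a::euclidean_space set"
  shows "packing_dim E \<le> ereal DIM('a)"
proof (rule dense_ge)
  fix y assume "ereal DIM('a) < y"
  then obtain s where s: "ereal DIM('a) < ereal s" "ereal s < y" using ereal_dense2 by blast
  then have "packing_dim E \<le> ereal s"
    unfolding packing_dim_def by (intro Inf_lower) (auto intro: packing_measure_eq_0)
  with s(2) show "packing_dim E \<le> y" by order
qed

lemma packing_content_ge_of_dense:
  fixes F :: "'a::euclidean_space set" and s :: real
  assumes "0 < r" "0 \<le> R" and dense: "cball a R \<subseteq> closure F"
  shows "ennreal ((R / 3) ^ DIM('a) * 2 powr s / r powr (DIM('a) - s)) \<le> packing_content s r F"
proof (cases "packing_content s r F < \<infinity>")
  case True
  with \<open>0 < r\<close> obtain G where G: "finite G" "F \<subseteq> (\<Union>g\<in>G. ball g (3 * r))"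
      "ennreal (real (card G) * (2 * r) powr s) \<le> packing_content s r F"
    by (rule packing_content_net_exists)
  have "F \<subseteq> (\<Union>g\<in>G. cball g (3 * r))" using G(2) ball_subset_cball by blast
  then have "closure F \<subseteq> (\<Union>g\<in>G. cball g (3 * r))"
    using G(1) by (intro closure_minimal closed_UN) auto
  with dense have "cball a R \<subseteq> (\<Union>g\<in>G. cball g (3 * r))" by (rule order_trans)
  then have "R ^ DIM('a) \<le> (\<Sum>g\<in>G. (3 * r) ^ DIM('a))"
    using G(1) assms(1,2) by (intro radius_power_le_of_cover[where c = "\<lambda>g. g"]) auto
  then have "(R / 3) ^ DIM('a) \<le> real (card G) * r powr DIM('a)"
    using \<open>0 < r\<close> by (simp add: power_divide power_mult_distrib powr_realpow field_simps)
  then have "(R / 3) ^ DIM('a) * 2 powr s / r powr (DIM('a) - s)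
      \<le> real (card G) * r powr DIM('a) * 2 powr s / r powr (DIM('a) - s)"
    by (intro divide_right_mono mult_right_mono) auto
  also have "\<dots> = real (card G) * (2 * r) powr s"
    using \<open>0 < r\<close> by (simp add: powr_diff powr_mult)
  finally show ?thesis using G(3) by (meson ennreal_leI order_trans)
qed (simp add: not_less top_unique)

lemma packing_premeasure_somewhere_dense:
  fixes F :: "'a::euclidean_space set" and s :: real
  assumes "s < DIM('a)" and dense: "interior (closure F) \<noteq> {}"
  shows "packing_premeasure s F = \<infinity>"
proof -
  obtain a R where R: "0 < R" "cball a R \<subseteq> closure F"
    using dense by (auto simp: mem_interior_cball)
  define c where "c = (R / 3) ^ DIM('a) * 2 powr s"
  have "((\<lambda>r. r powr (DIM('a) - s)) \<longlongrightarrow> 0 powr (DIM('a) - s)) (at_right 0)"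
    using \<open>s < DIM('a)\<close> by (intro tendsto_intros) (auto intro!: eventually_at_rightI[of 0 1])
  then have "LIM r at_right 0. c * inverse (r powr (DIM('a) - s)) :> at_top"
    using R by (intro filterlim_tendsto_pos_mult_at_top[OF tendsto_const] filterlim_inverse_at_top)
      (auto simp: c_def intro!: eventually_at_rightI[of 0 1])
  then have lim: "((\<lambda>r. ennreal (c / r powr (DIM('a) - s))) \<longlongrightarrow> \<infinity>) (at_right 0)"
    by (simp add: ennreal_tendsto_top_eq_at_top divide_inverse)
  have "\<infinity> \<le> packing_content s \<delta> F" if "0 < \<delta>" for \<delta>
  proof (rule tendsto_upperbound[OF lim])
    show "\<forall>\<^sub>F r in at_right 0. ennreal (c / r powr (DIM('a) - s)) \<le> packing_content s \<delta> F"
    proof (rule eventually_at_rightI)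
      fix r assume "r \<in> {0<..<\<delta>}"
      then have "ennreal (c / r powr (DIM('a) - s)) \<le> packing_content s r F"
        unfolding c_def using R by (intro packing_content_ge_of_dense) auto
      also have "\<dots> \<le> packing_content s \<delta> F"
        using \<open>r \<in> {0<..<\<delta>}\<close> by (intro packing_content_mono) simp
      finally show "ennreal (c / r powr (DIM('a) - s)) \<le> packing_content s \<delta> F" .
    qed (use that in simp)
  qed simp
  then have "\<infinity> \<le> packing_premeasure s F"
    unfolding packing_premeasure_altdef by (intro INF_greatest) simp
  then show ?thesis by (simp add: top_unique)
qed

lemma packing_measure_comeager_eq_infinity:
  fixes E :: "'a::euclidean_space set" and D :: "nat \<Rightarrow> 'a set" and s :: real
  assumes "s < DIM('a)" "open U" "U \<noteq> {}"
    and D: "\<And>n. open (D n)" "\<And>n. closure (D n) = UNIV" and sub: "U \<inter> (\<Inter>n. D n) \<subseteq> E"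
  shows "packing_measure s E = \<infinity>"
proof -
  have "(\<Sum>i. packing_premeasure s (F i)) = \<infinity>" if F: "E \<subseteq> (\<Union>i. F i)" for F :: "nat \<Rightarrow> 'a set"
  proof -
    have "\<exists>i. interior (closure (F i)) \<noteq> {}"
    proof (rule ccontr)
      assume nowhere_dense: "\<not> ?thesis"
      define \<G> where "\<G> = range D \<union> range (\<lambda>i. - closure (F i))"
      have "UNIV \<subseteq> closure (\<Inter>\<G>)"
      proof (rule Baire)
        fix T assume "T \<in> \<G>"
        then show "openin (top_of_set UNIV) T \<and> UNIV \<subseteq> closure T"
          using D nowhere_dense by (auto simp: \<G>_def closure_complement)
      qed (auto simp: \<G>_def)
      then have "U \<inter> \<Inter>\<G> \<noteq> {}"
        using \<open>open U\<close> \<open>U \<noteq> {}\<close> open_Int_closure_eq_empty[of U "\<Inter>\<G>"] by auto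
      then obtain z where "z \<in> U" "z \<in> \<Inter>\<G>" by blast
      then have "z \<in> D n" and z: "z \<notin> closure (F n)" for n
        by (auto simp: \<G>_def)
      with \<open>z \<in> U\<close> have "z \<in> E" using sub by blast
      then obtain i where "z \<in> F i" using F by blast
      with z show False using closure_subset by blast
    qed
    then obtain i where "interior (closure (F i)) \<noteq> {}" ..
    then have "packing_premeasure s (F i) = \<infinity>"
      using \<open>s < DIM('a)\<close> by (intro packing_premeasure_somewhere_dense)
    moreover have "packing_premeasure s (F i) \<le> (\<Sum>i. packing_premeasure s (F i))"
      using sum_le_suminf[of "\<lambda>i. packing_premeasure s (F i)" "{i}"] by simp
    ultimately show ?thesis by (simp add: top_unique)
  qed
  then show ?thesis
    unfolding packing_measure_def by simp
qed

subsection \<open>Limsup sets of balls\<close>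

definition limsup_balls :: "('a::metric_space \<times> real) set \<Rightarrow> 'a set" where
  "limsup_balls B = {z. \<forall>e>0. \<exists>(g, r)\<in>B. r < e \<and> dist g z \<le> r}"

lemma limsup_balls_comeager:
  fixes B :: "('a::metric_space \<times> real) set"
  assumes dense: "\<And>z e. 0 < e \<Longrightarrow> \<exists>(g, r)\<in>B. dist g z < e \<and> 0 < r \<and> r < e"
  shows "\<exists>D :: nat \<Rightarrow> 'a set. (\<forall>n. open (D n) \<and> closure (D n) = UNIV) \<and> (\<Inter>n. D n) \<subseteq> limsup_balls B"
proof (intro exI conjI allI)
  define D where "D n = (\<Union>(g, r)\<in>{(g, r) \<in> B. r < 1 / Suc n}. ball g r)" for n
  show "open (D n)" for n by (auto simp: D_def)
  show "closure (D n) = UNIV" for n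
  proof -
    have "\<exists>g\<in>D n. dist g z < e" if "0 < e" for z e
    proof -
      have "0 < min e (1 / Suc n)" using that by simp
      then obtain g r where "(g, r) \<in> B" "dist g z < e" "0 < r" "r < 1 / Suc n"
        using dense by fastforce
      then have "g \<in> D n" unfolding D_def by (intro UN_I[of "(g, r)"]) auto
      then show ?thesis using \<open>dist g z < e\<close> by blast
    qed
    then show ?thesis by (auto simp: closure_approachable)
  qed
  show "(\<Inter>n. D n) \<subseteq> limsup_balls B"
    unfolding limsup_balls_def
  proof clarify
    fix z and e :: real assume z: "z \<in> (\<Inter>n. D n)" and "0 < e"
    then obtain n where n: "1 / real (Suc n) < e"
      using reals_Archimedean by (auto simp: inverse_eq_divide)
    have "z \<in> D n" using z by blast
    then obtain g r where "(g, r) \<in> B" "r < 1 / Suc n" "dist g z < r"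
      by (auto simp: D_def)
    with n show "\<exists>(g, r)\<in>B. r < e \<and> dist g z \<le> r"
      by (intro bexI[of _ "(g, r)"]) auto
  qed
qed

lemma packing_dim_limsup_balls_dense:
  fixes B :: "('a::euclidean_space \<times> real) set"
  assumes "open U" "U \<noteq> {}"
    and dense: "\<And>z e. 0 < e \<Longrightarrow> \<exists>(g, r)\<in>B. dist g z < e \<and> 0 < r \<and> r < e"
  shows "packing_dim (U \<inter> limsup_balls B) = DIM('a)"
proof (rule antisym[OF packing_dim_le_DIM])
  have "\<exists>D :: nat \<Rightarrow> 'a set. (\<forall>n. open (D n) \<and> closure (D n) = UNIV) \<and> (\<Inter>n. D n) \<subseteq> limsup_balls B"
    using dense by (rule limsup_balls_comeager)
  then obtain D :: "nat \<Rightarrow> 'a set"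
    where D: "\<And>n. open (D n)" "\<And>n. closure (D n) = UNIV" "(\<Inter>n. D n) \<subseteq> limsup_balls B" by blast
  have infinite: "packing_measure s (U \<inter> limsup_balls B) = \<infinity>" if "s < DIM('a)" for s :: real
    using that \<open>open U\<close> \<open>U \<noteq> {}\<close> D by (intro packing_measure_comeager_eq_infinity[of s U D]) auto
  show "ereal DIM('a) \<le> packing_dim (U \<inter> limsup_balls B)"
    unfolding packing_dim_def
  proof (rule Inf_greatest)
    fix y assume "y \<in> {ereal s | s. 0 \<le> s \<and> packing_measure s (U \<inter> limsup_balls B) = 0}"
    then obtain s where "y = ereal s" "packing_measure s (U \<inter> limsup_balls B) = 0" by blast
    with infinite[of s] show "ereal DIM('a) \<le> y" by (cases "s < DIM('a)") auto
  qed
qed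

subsection \<open>Ubiquitous systems of balls\<close>

lemma halving_tendsto_0:
  fixes r :: "nat \<Rightarrow> real"
  assumes "\<And>n. 0 < r n" and half: "\<And>n. r (Suc n) \<le> r n / 2"
  shows "r \<longlonglongrightarrow> 0"
proof (rule real_tendsto_sandwich[where f = "\<lambda>_. 0" and h = "\<lambda>n. r 0 * (1 / 2) ^ n"])
  have "r n \<le> r 0 * (1 / 2) ^ n" for n
  proof (induction n)
    case (Suc n)
    then show ?case using half[of n] by simp
  qed simp
  then show "\<forall>\<^sub>F n in sequentially. r n \<le> r 0 * (1 / 2) ^ n" by (intro always_eventually allI)
  show "\<forall>\<^sub>F n in sequentially. 0 \<le> r n" using assms by (simp add: less_imp_le)
  show "(\<lambda>n. r 0 * (1 / 2) ^ n) \<longlonglongrightarrow> 0"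
    by (intro tendsto_mult_right_zero LIMSEQ_power_zero) simp
qed simp

lemma halving_balls_common_point:
  fixes y :: "nat \<Rightarrow> 'a::complete_space" and r :: "nat \<Rightarrow> real"
  assumes pos: "\<And>n. 0 < r n" and half: "\<And>n. r (Suc n) \<le> r n / 2"
    and step: "\<And>n. dist (y n) (y (Suc n)) \<le> r n / 2"
  obtains z where "\<And>n. z \<in> cball (y n) (r n)"
proof -
  have nested: "cball (y (Suc n)) (r (Suc n)) \<subseteq> cball (y n) (r n)" for n
  proof
    fix z assume "z \<in> cball (y (Suc n)) (r (Suc n))"
    then show "z \<in> cball (y n) (r n)"
      using half[of n] step[of n] dist_triangle[of "y n" z "y (Suc n)"] by simp
  qed
  obtain z where "\<And>n. z \<in> cball (y n) (r n)"
  proof (rule decreasing_closed_nest[of "\<lambda>n. cball (y n) (r n)"])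
    show "cball (y n) (r n) \<subseteq> cball (y m) (r m)" if "m \<le> n" for m n
      using nested that by (rule lift_Suc_antimono_le)
    show "cball (y n) (r n) \<noteq> {}" for n using pos[of n] by simp
    show "\<exists>n. \<forall>u\<in>cball (y n) (r n). \<forall>v\<in>cball (y n) (r n). dist u v < e" if "0 < e" for e
    proof -
      have "\<forall>\<^sub>F n in sequentially. r n < e / 2"
        using halving_tendsto_0[of r, OF pos half] that by (intro order_tendstoD(2)) auto
      then obtain n where n: "r n < e / 2" by (auto simp: eventually_sequentially)
      have "dist u v < e" if "u \<in> cball (y n) (r n)" "v \<in> cball (y n) (r n)" for u v
        using that n dist_triangle3[of u v "y n"] by simp
      then show ?thesis by blast
    qed
  qed auto
  then show thesis by (rule that)
qed

text \<open>
  Up to constants, \<open>(r / d)\<^sup>n\<close> is the largest number of \<open>d\<close>-separated points in an \<open>n\<close>-dimensional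
  ball of radius \<open>r\<close>, and \<open>\<kappa>\<close> is the proportion of it that is reached. A large \<open>M\<close> makes the
  \<open>s\<close>-dimensional volume of the subballs exceed that of the ball.
\<close>

definition branches :: "real \<Rightarrow> real \<Rightarrow> real \<Rightarrow> ('a::euclidean_space \<times> real) set \<Rightarrow> 'a \<Rightarrow> real \<Rightarrow> bool" where
  "branches s \<kappa> M B y r \<longleftrightarrow>
     (\<exists>G d r'. G \<subseteq> cball y (r / 2) \<and> separated d G \<and> \<kappa> * (r / d) ^ DIM('a) \<le> card G \<and>
        0 < r' \<and> 2 * r' \<le> d \<and> d \<le> r \<and> M * d ^ DIM('a) \<le> r' powr s \<and> (\<forall>g\<in>G. (g, r') \<in> B))"

definition ubiquitous :: "real \<Rightarrow> real \<Rightarrow> ('a::euclidean_space \<times> real) set \<Rightarrow> bool" where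
  "ubiquitous s \<kappa> B \<longleftrightarrow> (\<forall>y r M. 0 < r \<longrightarrow> r \<le> 1 \<longrightarrow> branches s \<kappa> M B y r)"

text \<open>
  If the loads of the ball \<open>cball y r\<close> add up to less than 1, no ball \<open>cball (x i) (\<rho> i)\<close>
  with \<open>r \<le> \<rho> i\<close> meets it. The smaller balls are weighted in such a way that lightness can be
  passed on to a subball by averaging.
\<close>

locale ball_sequence =
  fixes x :: "nat \<Rightarrow> 'a::euclidean_space" and \<rho> :: "nat \<Rightarrow> real" and s c :: real
  assumes radius_pos: "\<And>i. 0 < \<rho> i" and summable_radius_powr: "summable (\<lambda>i. \<rho> i powr s)"
    and s: "0 < s" "s \<le> DIM('a)" and c: "0 < c" "c \<le> 1"
begin

definition load :: "'a \<Rightarrow> real \<Rightarrow> nat \<Rightarrow> real" where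
  "load y r i = (if dist y (x i) \<le> r + \<rho> i then min 1 (\<rho> i powr s / (c * r powr s)) else 0)"

definition light :: "'a \<Rightarrow> real \<Rightarrow> bool" where
  "light y r \<longleftrightarrow> suminf (load y r) < 1"

lemma load_nonneg: "0 \<le> load y r i"
  using c by (simp add: load_def)

lemma load_le: "load y r i \<le> \<rho> i powr s / (c * r powr s)"
  using c by (simp add: load_def)

lemma summable_load: "summable (load y r)"
  by (rule summable_comparison_test'[OF summable_divide[OF summable_radius_powr, of "c * r powr s"]])
    (simp add: load_nonneg load_le)

lemma light_if_suminf_radius_powr_less:
  assumes "0 < r" "(\<Sum>i. \<rho> i powr s) < c * r powr s"
  shows "light y r"
proof -
  have "suminf (load y r) \<le> (\<Sum>i. \<rho> i powr s / (c * r powr s))"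
    by (intro suminf_le load_le summable_load summable_divide summable_radius_powr)
  also have "\<dots> = (\<Sum>i. \<rho> i powr s) / (c * r powr s)"
    using summable_radius_powr by (rule suminf_divide)
  also have "\<dots> < 1" using assms c by simp
  finally show ?thesis by (simp add: light_def)
qed

lemma
  assumes "light y r" "0 < r" "dist y (x i) \<le> r + \<rho> i"
  shows load_eq_if_light_meets: "load y r i = \<rho> i powr s / (c * r powr s)"
    and radius_less_if_light_meets: "\<rho> i < r"
proof -
  have "load y r i \<le> suminf (load y r)"
    using sum_le_suminf[OF summable_load, of "{i}"] load_nonneg by simp
  also have "\<dots> < 1" using assms(1) by (simp add: light_def)
  finally have "min 1 (\<rho> i powr s / (c * r powr s)) < 1" using assms by (simp add: load_def)
  then have less: "\<rho> i powr s / (c * r powr s) < 1" by simp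
  then show "load y r i = \<rho> i powr s / (c * r powr s)"
    using assms(3) by (simp add: load_def)
  have "\<rho> i powr s < c * r powr s" using less c \<open>0 < r\<close> by simp
  also have "\<dots> \<le> r powr s" using c by (simp add: mult_left_le_one_le)
  finally have "\<rho> i powr s < r powr s" .
  then show "\<rho> i < r"
    using powr_mono2[of s r "\<rho> i"] s \<open>0 < r\<close> by (auto simp: not_less[symmetric])
qed

lemma light_avoids:
  assumes "light y r" "0 < r" "r \<le> \<rho> i" "z \<in> cball y r"
  shows "z \<notin> cball (x i) (\<rho> i)"
proof
  assume "z \<in> cball (x i) (\<rho> i)"
  then have "dist y (x i) \<le> r + \<rho> i"
    using \<open>z \<in> cball y r\<close> dist_triangle2[of y "x i" z] by (simp add: dist_commute)
  with radius_less_if_light_meets[OF assms(1,2)] \<open>r \<le> \<rho> i\<close> show False by force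
qed

lemma radius_power_le_load:
  assumes "light y r" "0 < r" "dist y (x i) \<le> r + \<rho> i"
  shows "\<rho> i ^ DIM('a) \<le> c * r ^ DIM('a) * load y r i"
proof -
  let ?n = "DIM('a)"
  have "\<rho> i ^ ?n = \<rho> i powr s * \<rho> i powr (?n - s)"
    using radius_pos[of i] by (simp add: powr_add[symmetric] powr_realpow)
  also have "\<dots> \<le> \<rho> i powr s * r powr (?n - s)"
    using radius_less_if_light_meets[OF assms] radius_pos[of i] s
    by (intro mult_left_mono powr_mono2) auto
  also have "\<dots> = c * r ^ ?n * load y r i"
    using \<open>0 < r\<close> c by (simp add: load_eq_if_light_meets[OF assms] powr_diff powr_realpow)
  finally show ?thesis .
qed

lemma card_near_le:
  assumes "separated d G" "0 < r'" "2 * r' \<le> d"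
  shows "real (card {g \<in> G. dist g (x i) \<le> r' + \<rho> i}) \<le> 4 ^ DIM('a) * (1 + (\<rho> i / d) ^ DIM('a))"
proof -
  let ?n = "DIM('a)" and ?t = "\<rho> i / d"
  have "0 < d" "0 \<le> ?t" using assms radius_pos[of i] by auto
  have "real (card {g \<in> G. dist g (x i) \<le> r' + \<rho> i}) \<le> (2 * (r' + \<rho> i) / d + 1) ^ ?n"
    using assms radius_pos[of i]
    by (intro card_separated_le[where w = "x i"])
      (auto simp: dist_commute intro: separated_subset)
  also have "\<dots> \<le> (4 * max 1 ?t) ^ ?n"
  proof (rule power_mono)
    have "2 * r' / d \<le> 1" using assms \<open>0 < d\<close> by simp
    moreover have "2 * (r' + \<rho> i) / d + 1 = 2 * r' / d + 2 * ?t + 1"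
      by (simp add: add_divide_distrib distrib_left)
    ultimately show "2 * (r' + \<rho> i) / d + 1 \<le> 4 * max 1 ?t" by linarith
  qed (use assms radius_pos[of i] in auto)
  also have "\<dots> = 4 ^ ?n * max 1 ?t ^ ?n" by (rule power_mult_distrib)
  also have "max 1 ?t ^ ?n \<le> 1 + ?t ^ ?n" using \<open>0 \<le> ?t\<close> by (simp add: max_def)
  finally show ?thesis by simp
qed

lemma sum_load_le:
  assumes "light y r" "0 < r" and G: "finite G" "G \<subseteq> cball y (r / 2)" "separated d G"
    and r': "0 < r'" "2 * r' \<le> d" "2 * r' \<le> r"
  shows "(\<Sum>g\<in>G. load g r' i) \<le> 4 ^ DIM('a) * ((r / r') powr s + c * (r / d) ^ DIM('a)) * load y r i"
proof (cases "dist y (x i) \<le> r + \<rho> i")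
  case False
  have "load g r' i = 0" if "g \<in> G" for g
  proof -
    have "dist y g \<le> r / 2" using G that by auto
    then have "\<not> dist g (x i) \<le> r' + \<rho> i"
      using False r' dist_triangle[of y "x i" g] by linarith
    then show ?thesis by (simp add: load_def)
  qed
  then show ?thesis using False by (simp add: load_def)
next
  case True
  let ?n = "DIM('a)"
  define v where "v = min 1 (\<rho> i powr s / (c * r' powr s))"
  have v: "0 \<le> v" "v \<le> 1" "v \<le> \<rho> i powr s / (c * r' powr s)" using c by (auto simp: v_def)
  have "0 < d" using r' by simp
  note load_parent = load_eq_if_light_meets[OF \<open>light y r\<close> \<open>0 < r\<close> True]
  have "(\<Sum>g\<in>G. load g r' i) = (\<Sum>g\<in>G. if dist g (x i) \<le> r' + \<rho> i then v else 0)"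
    by (simp only: load_def v_def)
  also have "\<dots> = card {g \<in> G. dist g (x i) \<le> r' + \<rho> i} * v"
    using \<open>finite G\<close> by (simp add: sum.inter_filter[symmetric])
  also have "\<dots> \<le> 4 ^ ?n * (1 + (\<rho> i / d) ^ ?n) * v"
    using v G r' by (intro mult_right_mono card_near_le) auto
  also have "\<dots> \<le> 4 ^ ?n * (v + (\<rho> i / d) ^ ?n)"
    using v radius_pos[of i] \<open>0 < d\<close> by (simp add: distrib_left distrib_right mult_left_le)
  also have "\<dots> \<le> 4 ^ ?n * ((r / r') powr s * load y r i + c * (r / d) ^ ?n * load y r i)"
  proof (intro mult_left_mono add_mono)
    show "v \<le> (r / r') powr s * load y r i"
      using v(3) \<open>0 < r\<close> \<open>0 < r'\<close> by (simp add: load_parent powr_divide mult.commute)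
    have "\<rho> i ^ ?n \<le> c * r ^ ?n * load y r i"
      using \<open>light y r\<close> \<open>0 < r\<close> True by (rule radius_power_le_load)
    then show "(\<rho> i / d) ^ ?n \<le> c * (r / d) ^ ?n * load y r i"
      using \<open>0 < d\<close> by (simp add: power_divide divide_right_mono)
  qed simp
  finally show ?thesis by (simp add: algebra_simps)
qed

lemma light_child_exists:
  assumes "light y r" "0 < r" and G: "finite G" "G \<subseteq> cball y (r / 2)" "separated d G"
    and r': "0 < r'" "2 * r' \<le> d" "2 * r' \<le> r"
    and many: "2 * 4 ^ DIM('a) * c * (r / d) ^ DIM('a) \<le> card G"
    and large: "(r / r') powr s \<le> c * (r / d) ^ DIM('a)"
  obtains g where "g \<in> G" "light g r'"
proof -
  let ?K = "4 ^ DIM('a) * ((r / r') powr s + c * (r / d) ^ DIM('a))"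
  have "0 < ?K" using \<open>0 < r\<close> r' c by (intro mult_pos_pos add_pos_pos) auto
  have "(\<Sum>g\<in>G. suminf (load g r')) = (\<Sum>i. \<Sum>g\<in>G. load g r' i)"
    by (rule suminf_sum[symmetric]) (rule summable_load)
  also have "\<dots> \<le> (\<Sum>i. ?K * load y r i)"
    using assms by (intro suminf_le sum_load_le summable_sum summable_load summable_mult) auto
  also have "\<dots> = ?K * suminf (load y r)" by (rule suminf_mult[OF summable_load])
  also have "\<dots> < ?K * 1"
    using \<open>light y r\<close> \<open>0 < ?K\<close> by (intro mult_strict_left_mono) (auto simp: light_def)
  also have "?K \<le> 4 ^ DIM('a) * (c * (r / d) ^ DIM('a) + c * (r / d) ^ DIM('a))"
    using large by (intro mult_left_mono add_right_mono) auto
  also have "\<dots> \<le> card G" using many by simp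
  finally have "(\<Sum>g\<in>G. suminf (load g r')) < (\<Sum>g\<in>G. 1)" by simp
  then have "\<exists>g\<in>G. suminf (load g r') < 1" by (meson not_less sum_mono)
  then show thesis using that by (auto simp: light_def)
qed

lemma light_ubiquitous_child_exists:
  assumes "ubiquitous s (2 * 4 ^ DIM('a) * c) B" "light y r" "0 < r" "r \<le> 1"
  obtains g r' where "(g, r') \<in> B" "0 < r'" "r' \<le> r / 2" "dist y g \<le> r / 2" "light g r'"
proof -
  obtain G d r' where G: "G \<subseteq> cball y (r / 2)" "separated d G" "\<And>g. g \<in> G \<Longrightarrow> (g, r') \<in> B"
    and many: "2 * 4 ^ DIM('a) * c * (r / d) ^ DIM('a) \<le> card G"
    and r': "0 < r'" "2 * r' \<le> d" "d \<le> r"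
    and large: "r powr s / (c * r ^ DIM('a)) * d ^ DIM('a) \<le> r' powr s"
    using assms(1,3,4) unfolding ubiquitous_def branches_def by metis
  have "finite G" using finite_separated[OF G(2) _ _ G(1)] r' \<open>0 < r\<close> by simp
  have "(r / r') powr s \<le> c * (r / d) ^ DIM('a)"
    using large r' c \<open>0 < r\<close> by (simp add: powr_divide power_divide field_simps)
  then obtain g where "g \<in> G" "light g r'"
    using light_child_exists[OF assms(2,3) \<open>finite G\<close> G(1,2) r'(1,2) _ many] r' by auto
  then show thesis using that[of g r'] G r' by auto
qed

lemma light_chain_exists:
  assumes ubiquitous: "ubiquitous s (2 * 4 ^ DIM('a) * c) B"
    and start: "light y\<^sub>0 r\<^sub>0" "0 < r\<^sub>0" "r\<^sub>0 \<le> 1"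
  obtains y r where "y 0 = y\<^sub>0" "r 0 = r\<^sub>0"
    "\<And>n. light (y n) (r n)" "\<And>n. 0 < r n" "\<And>n. (y (Suc n), r (Suc n)) \<in> B"
    "\<And>n. r (Suc n) \<le> r n / 2" "\<And>n. dist (y n) (y (Suc n)) \<le> r n / 2"
proof -
  define P where "P n a \<longleftrightarrow> light (fst a) (snd a) \<and> 0 < snd a \<and> snd a \<le> 1 \<and> (n = 0 \<longrightarrow> a = (y\<^sub>0, r\<^sub>0))"
    for n :: nat and a :: "'a \<times> real"
  define Q where "Q a a' \<longleftrightarrow> a' \<in> B \<and> snd a' \<le> snd a / 2 \<and> dist (fst a) (fst a') \<le> snd a / 2"
    for a a' :: "'a \<times> real"
  have "\<exists>f. \<forall>n. P n (f n) \<and> Q (f n) (f (Suc n))"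
  proof (rule dependent_nat_choice)
    show "\<exists>a. P 0 a" using start by (auto simp: P_def)
    fix a n assume P: "P n a"
    then obtain g r' where "(g, r') \<in> B" "0 < r'" "r' \<le> snd a / 2" "dist (fst a) g \<le> snd a / 2"
      and "light g r'"
      using light_ubiquitous_child_exists[OF ubiquitous, of "fst a" "snd a"]
      unfolding P_def by blast
    then have "P (Suc n) (g, r') \<and> Q a (g, r')" using P by (simp add: P_def Q_def)
    then show "\<exists>a'. P (Suc n) a' \<and> Q a a'" ..
  qed
  then obtain f where f: "\<And>n. P n (f n)" "\<And>n. Q (f n) (f (Suc n))" by blast
  show thesis
    by (rule that[of "fst \<circ> f" "snd \<circ> f"]) (use f f(1)[of 0] in \<open>auto simp: P_def Q_def\<close>)
qed

lemma uncovered_limsup_point_exists: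
  assumes "ubiquitous s (2 * 4 ^ DIM('a) * c) B" "light y\<^sub>0 r\<^sub>0" "0 < r\<^sub>0" "r\<^sub>0 \<le> 1"
  shows "\<exists>z \<in> cball y\<^sub>0 r\<^sub>0 \<inter> limsup_balls B. \<forall>i. z \<notin> cball (x i) (\<rho> i)"
proof -
  obtain y r where start: "y 0 = y\<^sub>0" "r 0 = r\<^sub>0"
    and light: "\<And>n. light (y n) (r n)" and pos: "\<And>n. 0 < r n"
    and mem: "\<And>n. (y (Suc n), r (Suc n)) \<in> B"
    and half: "\<And>n. r (Suc n) \<le> r n / 2" and step: "\<And>n. dist (y n) (y (Suc n)) \<le> r n / 2"
    using light_chain_exists[OF assms] by metis
  obtain z where z: "\<And>n. z \<in> cball (y n) (r n)"
    using halving_balls_common_point[of r y, OF pos half step] by blast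
  have small: "\<exists>n. r (Suc n) < e" if "0 < e" for e
    using order_tendstoD(2)[OF LIMSEQ_Suc[OF halving_tendsto_0[of r, OF pos half]] that]
    by (auto simp: eventually_sequentially)
  have "z \<in> limsup_balls B"
    unfolding limsup_balls_def
  proof clarify
    fix e :: real assume "0 < e"
    then obtain n where "r (Suc n) < e" using small by blast
    then show "\<exists>(g, r)\<in>B. r < e \<and> dist g z \<le> r"
      using mem[of n] z[of "Suc n"] by (intro bexI) auto
  qed
  moreover have "z \<in> cball y\<^sub>0 r\<^sub>0" using z[of 0] start by simp
  moreover have "z \<notin> cball (x i) (\<rho> i)" for i
  proof -
    obtain n where "r (Suc n) < \<rho> i" using small radius_pos by blast
    then show ?thesis using light_avoids[OF light pos _ z, of "Suc n" i] by simp
  qed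
  ultimately show ?thesis by blast
qed

end

lemma hausdorff_measure_ubiquitous_neq_0:
  fixes B :: "('a::euclidean_space \<times> real) set"
  assumes "ubiquitous s \<kappa> B" "0 < \<kappa>" "\<kappa> \<le> 1" "0 < s" "s \<le> DIM('a)" "0 < r" "r \<le> 1"
  shows "hausdorff_measure s (cball y r \<inter> limsup_balls B) \<noteq> 0"
proof
  assume null: "hausdorff_measure s (cball y r \<inter> limsup_balls B) = 0"
  define c where "c = \<kappa> / (2 * 4 ^ DIM('a))"
  have "0 < c * r powr s" using assms by (simp add: c_def)
  with null \<open>0 < s\<close> obtain x \<rho> where cover: "cball y r \<inter> limsup_balls B \<subseteq> (\<Union>i. cball (x i) (\<rho> i))"
    and \<rho>: "\<And>i. 0 < \<rho> i" "summable (\<lambda>i. \<rho> i powr s)" "(\<Sum>i. \<rho> i powr s) < c * r powr s"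
    by (rule hausdorff_measure_eq_0_imp_small_cball_cover) (rule that)
  have "0 < c" using assms by (simp add: c_def)
  have "\<kappa> \<le> 2 * 4 ^ DIM('a)" using \<open>\<kappa> \<le> 1\<close> one_le_power[of "4::real" "DIM('a)"] by linarith
  then have "c \<le> 1" by (simp add: c_def)
  interpret ball_sequence x \<rho> s c
    using \<rho> assms \<open>0 < c\<close> \<open>c \<le> 1\<close> by unfold_locales auto
  have "light y r" using \<open>0 < r\<close> \<rho>(3) by (rule light_if_suminf_radius_powr_less)
  moreover have "ubiquitous s (2 * 4 ^ DIM('a) * c) B" using assms by (simp add: c_def)
  ultimately show False
    using uncovered_limsup_point_exists \<open>0 < r\<close> \<open>r \<le> 1\<close> cover by blast
qed

subsection \<open>Gaussian fractions\<close>

lemma gauss_ints_diff: "a \<in> gauss_ints \<Longrightarrow> b \<in> gauss_ints \<Longrightarrow> a - b \<in> gauss_ints"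
  and gauss_ints_mult: "a \<in> gauss_ints \<Longrightarrow> b \<in> gauss_ints \<Longrightarrow> a * b \<in> gauss_ints"
  and gauss_ints_of_nat: "of_nat n \<in> gauss_ints"
  by (auto simp: gauss_ints_def)

lemma gauss_ints_norm_ge_1:
  assumes "q \<in> gauss_ints" "q \<noteq> 0"
  shows "1 \<le> cmod q"
proof -
  have "\<bar>Re q\<bar> \<ge> 1 \<or> \<bar>Im q\<bar> \<ge> 1"
    using assms by (auto simp: gauss_ints_def complex_eq_iff Ints_nonzero_abs_ge1)
  then show ?thesis
    using abs_Re_le_cmod[of q] abs_Im_le_cmod[of q] by linarith
qed

lemma separated_gauss_ints: "separated 1 gauss_ints"
  by (auto simp: separated_def pairwise_def dist_norm gauss_ints_diff intro!: gauss_ints_norm_ge_1)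

lemma
  shows finite_gauss_ints_Int_cball: "finite (gauss_ints \<inter> cball w R)"
    and card_gauss_ints_Int_cball_le: "real (card (gauss_ints \<inter> cball w R)) \<le> (2 * R + 1)\<^sup>2"
proof -
  have "finite (gauss_ints \<inter> cball w R) \<and> real (card (gauss_ints \<inter> cball w R)) \<le> (2 * R + 1)\<^sup>2"
  proof (cases "0 \<le> R")
    case True
    have "separated 1 (gauss_ints \<inter> cball w R)"
      using separated_gauss_ints by (rule separated_subset) simp
    from finite_separated[OF this _ True, of w] card_separated_le[OF this _ True, of w]
    show ?thesis by simp
  qed simp
  then show "finite (gauss_ints \<inter> cball w R)"
    and "real (card (gauss_ints \<inter> cball w R)) \<le> (2 * R + 1)\<^sup>2" by auto
qed

lemma close_pair_in_unit_box:
  fixes f :: "'i \<Rightarrow> complex"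
  assumes "0 < n" "n\<^sup>2 < card A"
    and box: "\<And>a. a \<in> A \<Longrightarrow> 0 \<le> Re (f a) \<and> Re (f a) < 1 \<and> 0 \<le> Im (f a) \<and> Im (f a) < 1"
  obtains a b where "a \<in> A" "b \<in> A" "a \<noteq> b" "cmod (f a - f b) \<le> 2 / real n"
proof -
  define cell where "cell a = (nat \<lfloor>real n * Re (f a)\<rfloor>, nat \<lfloor>real n * Im (f a)\<rfloor>)" for a
  have index_less: "nat \<lfloor>real n * t\<rfloor> < n" if "0 \<le> t" "t < 1" for t
    using that \<open>0 < n\<close> by (simp add: nat_less_iff floor_less_iff)
  have close: "\<bar>t - u\<bar> \<le> 1 / real n"
    if "0 \<le> t" "0 \<le> u" "nat \<lfloor>real n * t\<rfloor> = nat \<lfloor>real n * u\<rfloor>" for t u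
  proof -
    have "\<lfloor>real n * t\<rfloor> = \<lfloor>real n * u\<rfloor>" using that by (simp add: eq_nat_nat_iff)
    then have "\<bar>real n * t - real n * u\<bar> \<le> 1" by linarith
    then have "real n * \<bar>t - u\<bar> \<le> 1" by (simp add: abs_mult right_diff_distrib[symmetric])
    then show ?thesis using \<open>0 < n\<close> by (simp add: field_simps)
  qed
  have "card (cell ` A) \<le> card ({..<n} \<times> {..<n})"
    using box by (intro card_mono) (auto simp: cell_def index_less)
  also have "\<dots> < card A" using \<open>n\<^sup>2 < card A\<close> by (simp add: power2_eq_square)
  finally have "\<not> inj_on cell A" by (rule pigeonhole)
  then obtain a b where ab: "a \<in> A" "b \<in> A" "a \<noteq> b" "cell a = cell b"
    by (auto simp: inj_on_def)
  have "cmod (f a - f b) \<le> \<bar>Re (f a) - Re (f b)\<bar> + \<bar>Im (f a) - Im (f b)\<bar>"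
    using cmod_le[of "f a - f b"] by simp
  also have "\<dots> \<le> 1 / real n + 1 / real n"
    using ab box[of a] box[of b] by (intro add_mono close) (auto simp: cell_def)
  finally show thesis using that[OF ab(1-3)] by simp
qed

lemma gauss_dirichlet_nat:
  fixes z :: complex
  assumes "0 < n"
  obtains p q where "p \<in> gauss_ints" "q \<in> gauss_ints" "q \<noteq> 0" "cmod q \<le> 2 * real n"
    "cmod (q * z - p) \<le> 2 / real n"
proof -
  define A where "A = (\<lambda>(a, b). Complex (real a) (real b)) ` ({..n} \<times> {..n})"
  define int_part where "int_part w = Complex (of_int \<lfloor>Re w\<rfloor>) (of_int \<lfloor>Im w\<rfloor>)" for w
  have A: "a \<in> gauss_ints" if "a \<in> A" for a
    using that by (auto simp: A_def gauss_ints_def)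
  have "card A = card ({..n} \<times> {..n})"
    unfolding A_def by (rule card_image) (auto simp: inj_on_def)
  then have "n\<^sup>2 < card A"
    by (simp add: card_cartesian_product power2_eq_square)
  then obtain a b where ab: "a \<in> A" "b \<in> A" "a \<noteq> b"
    and close: "cmod ((a * z - int_part (a * z)) - (b * z - int_part (b * z))) \<le> 2 / real n"
    by (rule close_pair_in_unit_box[OF \<open>0 < n\<close>, where f = "\<lambda>a. a * z - int_part (a * z)"])
      (auto simp: int_part_def, linarith+)
  define q p where "q = a - b" and "p = int_part (a * z) - int_part (b * z)"
  have "cmod q \<le> \<bar>Re q\<bar> + \<bar>Im q\<bar>" by (rule cmod_le)
  also have "\<dots> \<le> 2 * real n" using ab by (auto simp: q_def A_def)
  finally have "cmod q \<le> 2 * real n" .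
  moreover have "int_part w \<in> gauss_ints" for w by (simp add: int_part_def gauss_ints_def)
  then have "p \<in> gauss_ints" by (simp add: p_def gauss_ints_diff)
  moreover have "q \<in> gauss_ints" using ab A by (simp add: q_def gauss_ints_diff)
  moreover have "cmod (q * z - p) \<le> 2 / real n"
    using close by (simp add: p_def q_def algebra_simps)
  ultimately show thesis using that ab by (simp add: q_def)
qed

lemma gauss_dirichlet:
  fixes z :: complex
  assumes "2 \<le> Q"
  obtains p q where "p \<in> gauss_ints" "q \<in> gauss_ints" "q \<noteq> 0" "cmod q \<le> Q"
    "cmod (q * z - p) \<le> 8 / Q" "dist (p / q) z \<le> 8 / (Q * cmod q)"
proof -
  define n where "n = nat \<lfloor>Q / 2\<rfloor>"
  have "1 \<le> \<lfloor>Q / 2\<rfloor>" using assms by (simp add: le_floor_iff)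
  then have n: "2 * real n \<le> Q" "Q / 4 \<le> real n" "0 < n"
    unfolding n_def by linarith+
  obtain p q where pq: "p \<in> gauss_ints" "q \<in> gauss_ints" "q \<noteq> 0" "cmod q \<le> 2 * real n"
    and "cmod (q * z - p) \<le> 2 / real n"
    using gauss_dirichlet_nat[OF \<open>0 < n\<close>] by metis
  note this(5)
  also have "2 / real n \<le> 2 / (Q / 4)"
    using n assms by (intro divide_left_mono mult_pos_pos) auto
  finally have residual_le: "cmod (q * z - p) \<le> 8 / Q" by simp
  have "dist (p / q) z = cmod ((q * z - p) / q)"
    using \<open>q \<noteq> 0\<close> by (simp add: dist_norm norm_minus_commute diff_divide_distrib)
  also have "\<dots> \<le> 8 / Q / cmod q"
    unfolding norm_divide using residual_le by (rule divide_right_mono) simp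
  finally show thesis using that[of p q] pq n residual_le by simp
qed

definition gauss_fractions :: "real \<Rightarrow> complex set" where
  "gauss_fractions Q =
     {p / q | p q. p \<in> gauss_ints \<and> q \<in> gauss_ints \<and> q \<noteq> 0 \<and> cmod q \<le> Q}"

lemma separated_gauss_fractions: "separated (1 / Q\<^sup>2) (gauss_fractions Q)"
  unfolding separated_def
proof (rule pairwiseI)
  fix a b assume "a \<in> gauss_fractions Q" "b \<in> gauss_fractions Q" "a \<noteq> b"
  then obtain p q p' q' where ab: "a = p / q" "b = p' / q'"
    and ints: "p \<in> gauss_ints" "q \<in> gauss_ints" "p' \<in> gauss_ints" "q' \<in> gauss_ints"
    and q: "q \<noteq> 0" "q' \<noteq> 0" "cmod q \<le> Q" "cmod q' \<le> Q"
    by (auto simp: gauss_fractions_def)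
  have "p * q' - p' * q \<noteq> 0" using \<open>a \<noteq> b\<close> ab q by (auto simp: field_simps)
  then have "1 \<le> cmod (p * q' - p' * q)"
    using ints by (intro gauss_ints_norm_ge_1 gauss_ints_diff gauss_ints_mult)
  moreover have "0 < cmod q * cmod q'" "cmod q * cmod q' \<le> Q\<^sup>2"
    using q by (auto simp: power2_eq_square intro!: mult_mono order_trans[OF norm_ge_zero])
  ultimately have "1 / Q\<^sup>2 \<le> cmod (p * q' - p' * q) / (cmod q * cmod q')"
    by (intro frac_le) auto
  also have "\<dots> = dist a b"
    using q by (simp add: ab dist_norm diff_frac_eq norm_divide norm_mult)
  finally show "1 / Q\<^sup>2 \<le> dist a b" .
qed

text \<open>
  The pairs with \<open>|q| \<le> X\<close> that can occur in Dirichlet's theorem for the points of \<open>cball w \<rho>\<close>: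
  there \<open>|q w - p| \<le> |q| |w - z| + |q z - p|\<close>.
\<close>

definition gauss_pairs :: "complex \<Rightarrow> real \<Rightarrow> real \<Rightarrow> (complex \<times> complex) set" where
  "gauss_pairs w \<rho> X =
     (SIGMA q : gauss_ints \<inter> cball 0 X - {0}. gauss_ints \<inter> cball (q * w) (cmod q * \<rho> + 1))"

lemma finite_gauss_pairs: "finite (gauss_pairs w \<rho> X)"
  by (simp add: gauss_pairs_def finite_gauss_ints_Int_cball)

lemma card_numerators_div_norm_le:
  assumes "q \<in> gauss_ints" "q \<noteq> 0" "0 < \<rho>"
  shows "real (card (gauss_ints \<inter> cball (q * w) (cmod q * \<rho> + 1))) / (cmod q)\<^sup>2
    \<le> 25 * (\<rho>\<^sup>2 + indicator (cball 0 (1 / \<rho>)) q)"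
proof -
  let ?N = "real (card (gauss_ints \<inter> cball (q * w) (cmod q * \<rho> + 1)))"
  have q: "1 \<le> cmod q" using assms by (intro gauss_ints_norm_ge_1)
  have N: "?N \<le> (2 * (cmod q * \<rho>) + 3)\<^sup>2"
    using card_gauss_ints_Int_cball_le[of "q * w" "cmod q * \<rho> + 1"] by (simp add: algebra_simps)
  show ?thesis
  proof (cases "cmod q * \<rho> \<le> 1")
    case True
    note N
    also have "(2 * (cmod q * \<rho>) + 3)\<^sup>2 \<le> 5\<^sup>2" using True \<open>0 < \<rho>\<close> by (intro power_mono) auto
    also have "5\<^sup>2 \<le> 25 * (cmod q)\<^sup>2" using one_le_power[OF q, of 2] by simp
    finally have "?N / (cmod q)\<^sup>2 \<le> 25" using \<open>q \<noteq> 0\<close> by (simp add: pos_divide_le_eq)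
    moreover have "q \<in> cball 0 (1 / \<rho>)" using True \<open>0 < \<rho>\<close> by (simp add: field_simps)
    ultimately show ?thesis by (simp add: add_increasing)
  next
    case False
    note N
    also have "(2 * (cmod q * \<rho>) + 3)\<^sup>2 \<le> (5 * (cmod q * \<rho>))\<^sup>2"
      using False by (intro power_mono) linarith+
    finally have "?N / (cmod q)\<^sup>2 \<le> 25 * \<rho>\<^sup>2"
      using \<open>q \<noteq> 0\<close> by (simp add: pos_divide_le_eq power_mult_distrib mult_ac)
    then show ?thesis by (simp add: add_increasing2)
  qed
qed

lemma sum_gauss_pairs_inverse_norm_squared_le:
  assumes "0 < \<rho>" "\<rho> \<le> 1" "1 \<le> X"
  shows "(\<Sum>(q, p)\<in>gauss_pairs w \<rho> X. 1 / (cmod q)\<^sup>2) \<le> 225 * (\<rho>\<^sup>2 * X\<^sup>2 + 1 / \<rho>\<^sup>2)"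
proof -
  let ?S = "gauss_ints \<inter> cball 0 X - {0}" and ?T = "cball 0 (1 / \<rho>) :: complex set"
  have fin: "finite ?S" using finite_gauss_ints_Int_cball by blast
  have "(\<Sum>(q, p)\<in>gauss_pairs w \<rho> X. 1 / (cmod q)\<^sup>2)
      = (\<Sum>q\<in>?S. real (card (gauss_ints \<inter> cball (q * w) (cmod q * \<rho> + 1))) / (cmod q)\<^sup>2)"
    unfolding gauss_pairs_def
    by (subst sum.Sigma[symmetric]) (use fin finite_gauss_ints_Int_cball in auto)
  also have "\<dots> \<le> (\<Sum>q\<in>?S. 25 * (\<rho>\<^sup>2 + indicator ?T q))"
  proof (rule sum_mono)
    fix q assume "q \<in> ?S"
    then show "real (card (gauss_ints \<inter> cball (q * w) (cmod q * \<rho> + 1))) / (cmod q)\<^sup>2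
        \<le> 25 * (\<rho>\<^sup>2 + indicator ?T q)"
      using \<open>0 < \<rho>\<close> by (intro card_numerators_div_norm_le) auto
  qed
  also have "\<dots> = 25 * (\<rho>\<^sup>2 * card ?S + card (?S \<inter> ?T))"
  proof -
    have "(\<Sum>q\<in>?S. indicator ?T q) = real (card (?S \<inter> ?T))"
      using sum.inter_restrict[OF fin, of "\<lambda>_. 1 :: real" ?T]
      by (simp only: indicator_def of_bool_def sum_constant mult_1_right)
    then show ?thesis
      by (simp only: sum_distrib_left[symmetric] sum.distrib sum_constant mult.commute)
  qed
  also have "\<dots> \<le> 25 * (\<rho>\<^sup>2 * (9 * X\<^sup>2) + 9 / \<rho>\<^sup>2)"
  proof (intro mult_left_mono add_mono)
    have "real (card ?S) \<le> card (gauss_ints \<inter> cball 0 X)"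
      by (intro of_nat_mono card_mono finite_gauss_ints_Int_cball) auto
    also have "\<dots> \<le> (2 * X + 1)\<^sup>2" by (rule card_gauss_ints_Int_cball_le)
    also have "\<dots> \<le> (3 * X)\<^sup>2" using assms by (intro power_mono) auto
    finally show "real (card ?S) \<le> 9 * X\<^sup>2" by (simp add: power_mult_distrib)
    have "real (card (?S \<inter> ?T)) \<le> card (gauss_ints \<inter> ?T)"
      by (intro of_nat_mono card_mono finite_gauss_ints_Int_cball) auto
    also have "\<dots> \<le> (2 * (1 / \<rho>) + 1)\<^sup>2" by (rule card_gauss_ints_Int_cball_le)
    also have "\<dots> \<le> (3 / \<rho>)\<^sup>2" using assms by (intro power_mono) (auto simp: field_simps)
    finally show "real (card (?S \<inter> ?T)) \<le> 9 / \<rho>\<^sup>2" by (simp add: power_divide)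
  qed auto
  finally show ?thesis by simp
qed

lemma cball_subset_gauss_cover:
  assumes \<rho>: "0 < \<rho>" "\<rho> \<le> 1" and Q: "240 \<le> Q" "1920 / Q\<^sup>2 \<le> \<rho>"
  shows "cball w \<rho> \<subseteq> (\<Union>(q, p)\<in>gauss_pairs w \<rho> (Q / 240). cball (p / q) (8 / (Q * cmod q)))
    \<union> (\<Union>g\<in>gauss_fractions Q \<inter> cball w (2 * \<rho>). cball g (1920 / Q\<^sup>2))"
proof
  fix z assume z: "z \<in> cball w \<rho>"
  obtain p q where pq: "p \<in> gauss_ints" "q \<in> gauss_ints" "q \<noteq> 0" "cmod q \<le> Q"
    and residual_le: "cmod (q * z - p) \<le> 8 / Q" and dist: "dist (p / q) z \<le> 8 / (Q * cmod q)"
    using gauss_dirichlet[of Q z] Q by auto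
  consider (small) "cmod q \<le> Q / 240" | (large) "Q / 240 < cmod q" by linarith
  then show "z \<in> (\<Union>(q, p)\<in>gauss_pairs w \<rho> (Q / 240). cball (p / q) (8 / (Q * cmod q)))
    \<union> (\<Union>g\<in>gauss_fractions Q \<inter> cball w (2 * \<rho>). cball g (1920 / Q\<^sup>2))"
  proof cases
    case small
    have "cmod (q * w - p) \<le> cmod (q * (w - z)) + cmod (q * z - p)"
      using norm_triangle_ineq[of "q * (w - z)" "q * z - p"] by (simp add: algebra_simps)
    also have "\<dots> \<le> cmod q * \<rho> + 1"
    proof (rule add_mono)
      show "cmod (q * (w - z)) \<le> cmod q * \<rho>"
        using z by (simp add: norm_mult dist_norm mult_left_mono)
      have "8 / Q \<le> 1" using Q by simp
      then show "cmod (q * z - p) \<le> 1" using residual_le by linarith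
    qed
    finally have "(q, p) \<in> gauss_pairs w \<rho> (Q / 240)"
      using pq small by (simp add: gauss_pairs_def dist_norm)
    then show ?thesis using dist by force
  next
    case large
    have "8 / (Q * cmod q) \<le> 8 / (Q * (Q / 240))"
      using large Q \<open>q \<noteq> 0\<close> by (intro divide_left_mono mult_left_mono mult_pos_pos) auto
    then have dist: "dist (p / q) z \<le> 1920 / Q\<^sup>2"
      using dist by (simp add: power2_eq_square)
    then have "dist w (p / q) \<le> 2 * \<rho>"
      using z Q dist_triangle2[of w "p / q" z] by (simp add: dist_commute)
    then have "p / q \<in> gauss_fractions Q \<inter> cball w (2 * \<rho>)"
      using pq by (auto simp: gauss_fractions_def)
    then show ?thesis using dist by auto
  qed
qed

lemma sum_gauss_pairs_radius_squared_le:
  assumes \<rho>: "0 < \<rho>" "\<rho> \<le> 1" and Q: "240 \<le> Q" "240 \<le> Q * \<rho>\<^sup>2"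
  shows "(\<Sum>(q, p)\<in>gauss_pairs w \<rho> (Q / 240). (8 / (Q * cmod q))\<^sup>2) \<le> \<rho>\<^sup>2 / 2"
proof -
  let ?P = "gauss_pairs w \<rho> (Q / 240)"
  have "(\<Sum>(q, p)\<in>?P. (8 / (Q * cmod q))\<^sup>2) = 64 / Q\<^sup>2 * (\<Sum>(q, p)\<in>?P. 1 / (cmod q)\<^sup>2)"
    by (simp add: sum_distrib_left split_beta power_divide power_mult_distrib)
  also have "\<dots> \<le> 64 / Q\<^sup>2 * (225 * (\<rho>\<^sup>2 * (Q / 240)\<^sup>2 + 1 / \<rho>\<^sup>2))"
    using assms by (intro mult_left_mono sum_gauss_pairs_inverse_norm_squared_le) auto
  also have "\<dots> = \<rho>\<^sup>2 / 4 + 14400 / (Q\<^sup>2 * \<rho>\<^sup>2)"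
    using assms by (simp add: field_simps)
  also have "14400 / (Q\<^sup>2 * \<rho>\<^sup>2) \<le> \<rho>\<^sup>2 / 4"
  proof -
    have "240 * 240 \<le> (Q * \<rho>\<^sup>2) * (Q * \<rho>\<^sup>2)" using Q by (intro mult_mono) auto
    then have "57600 \<le> Q\<^sup>2 * \<rho>\<^sup>2 * \<rho>\<^sup>2" by (simp add: power2_eq_square mult_ac)
    then show ?thesis using assms by (simp add: field_simps)
  qed
  finally show ?thesis by simp
qed

lemma finite_gauss_fractions_Int_cball: "finite (gauss_fractions Q \<inter> cball w R)"
proof (cases "0 < Q \<and> 0 \<le> R")
  case True
  have "separated (1 / Q\<^sup>2) (gauss_fractions Q \<inter> cball w R)"
    using separated_gauss_fractions by (rule separated_subset) simp
  then show ?thesis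
    by (rule finite_separated[where w = w and R = R]) (use True in auto)
next
  case False
  have "cmod q \<le> Q \<Longrightarrow> q \<noteq> 0 \<Longrightarrow> 0 < Q" for q using zero_less_norm_iff[of q] by linarith
  with False have "gauss_fractions Q \<inter> cball w R = {}"
    by (auto simp: gauss_fractions_def intro: order_trans[OF zero_le_dist])
  then show ?thesis by simp
qed

text \<open>
  By Dirichlet's theorem, balls around the fractions with denominator at most \<open>Q\<close> cover the disc.
  The denominators up to \<open>Q/240\<close> account for at most half of its area, and all other balls
  have radius at most \<open>1920/Q\<^sup>2\<close>, so there must be many of them.
\<close>

lemma card_gauss_fractions_Int_cball_ge:
  assumes \<rho>: "0 < \<rho>" "\<rho> \<le> 1" and Q: "240 / \<rho>\<^sup>2 \<le> Q"
  shows "\<rho>\<^sup>2 * Q ^ 4 / (2 * 1920\<^sup>2) \<le> real (card (gauss_fractions Q \<inter> cball w (2 * \<rho>)))"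
proof -
  let ?G = "gauss_fractions Q \<inter> cball w (2 * \<rho>)"
  let ?P = "gauss_pairs w \<rho> (Q / 240)"
  have Q\<rho>: "240 \<le> Q * \<rho>\<^sup>2" using Q \<rho> by (simp add: field_simps)
  have "\<rho>\<^sup>2 \<le> 1" using \<rho> by (simp add: power_le_one)
  then have "240 \<le> 240 / \<rho>\<^sup>2" using \<rho> by (simp add: field_simps)
  with Q have "240 \<le> Q" by linarith
  have "240 * 240 \<le> Q * (Q * \<rho>\<^sup>2)" using Q\<rho> \<open>240 \<le> Q\<close> by (intro mult_mono) auto
  also have "\<dots> \<le> Q * (Q * \<rho>)"
    using \<rho> \<open>240 \<le> Q\<close> by (intro mult_left_mono) (auto simp: power2_eq_square mult_left_le)
  finally have "1920 / Q\<^sup>2 \<le> \<rho>" using \<open>240 \<le> Q\<close> by (simp add: field_simps power2_eq_square)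
  let ?center = "case_sum (\<lambda>(q, p). p / q) (\<lambda>g. g)"
  let ?radius = "case_sum (\<lambda>(q, p). 8 / (Q * cmod q)) (\<lambda>g. 1920 / Q\<^sup>2)"
  have "cball w \<rho> \<subseteq> (\<Union>i\<in>?P <+> ?G. cball (?center i) (?radius i))"
    using cball_subset_gauss_cover[OF \<rho> \<open>240 \<le> Q\<close> \<open>1920 / Q\<^sup>2 \<le> \<rho>\<close>, of w]
    by (simp add: Plus_def UN_Un split_beta image_Un)
  then have "\<rho>\<^sup>2 \<le> (\<Sum>i\<in>?P <+> ?G. (?radius i)\<^sup>2)"
    using \<rho> \<open>240 \<le> Q\<close> radius_power_le_of_cover[of "?P <+> ?G" \<rho> ?radius w ?center]
    by (force simp: finite_gauss_pairs finite_gauss_fractions_Int_cball split: sum.splits)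
  also have "\<dots> = (\<Sum>(q, p)\<in>?P. (8 / (Q * cmod q))\<^sup>2) + card ?G * (1920 / Q\<^sup>2)\<^sup>2"
    by (simp add: sum.Plus finite_gauss_pairs finite_gauss_fractions_Int_cball split_beta comp_def)
  also have "(\<Sum>(q, p)\<in>?P. (8 / (Q * cmod q))\<^sup>2) \<le> \<rho>\<^sup>2 / 2"
    using \<rho> \<open>240 \<le> Q\<close> Q\<rho> by (rule sum_gauss_pairs_radius_squared_le)
  finally have "\<rho>\<^sup>2 / 2 \<le> card ?G * (1920 / Q\<^sup>2)\<^sup>2" by simp
  then show ?thesis
    using \<open>240 \<le> Q\<close> by (simp add: field_simps power2_eq_square power4_eq_xxxx)
qed

subsection \<open>Approximation by Gaussian fractions\<close>

lemma dyadic_bounds: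
  fixes x :: real
  assumes "1 \<le> x" and n: "n = nat \<lfloor>log 2 x\<rfloor>"
  shows "2 ^ n \<le> x" "x \<le> 2 * 2 ^ n"
proof -
  have "0 \<le> log 2 x" using assms by simp
  then have "real n \<le> log 2 x" "log 2 x < real n + 1" by (simp_all add: n)
  then show "2 ^ n \<le> x" "x \<le> 2 * 2 ^ n"
    using \<open>1 \<le> x\<close> by (auto simp: le_log_iff log_less_iff powr_add powr_realpow)
qed

lemma sum_powr_dyadic_level_le:
  fixes f :: "'i \<Rightarrow> real"
  assumes growth: "\<And>R. 1 \<le> R \<Longrightarrow> finite {i \<in> I. f i \<le> R}"
      "\<And>R. 1 \<le> R \<Longrightarrow> real (card {i \<in> I. f i \<le> R}) \<le> C * R ^ k"
    and L: "L \<subseteq> I" "\<And>i. i \<in> L \<Longrightarrow> 2 ^ j \<le> f i" "\<And>i. i \<in> L \<Longrightarrow> f i \<le> 2 * 2 ^ j"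
    and "0 \<le> a"
  shows "(\<Sum>i\<in>L. f i powr - a) \<le> C * 2 ^ k * (2 powr (k - a)) ^ j"
proof -
  have "1 \<le> 2 * (2::real) ^ j" using one_le_power[of "2::real" j] by linarith
  have "(\<Sum>i\<in>L. f i powr - a) \<le> (\<Sum>i\<in>L. (2 ^ j) powr - a)"
    using L(2) \<open>0 \<le> a\<close> by (intro sum_mono powr_mono2') auto
  also have "\<dots> = card L * (2 ^ j) powr - a" by simp
  also have "\<dots> \<le> C * (2 * 2 ^ j) ^ k * (2 ^ j) powr - a"
  proof (rule mult_right_mono)
    have "real (card L) \<le> card {i \<in> I. f i \<le> 2 * 2 ^ j}"
      using L \<open>1 \<le> 2 * (2::real) ^ j\<close> by (intro of_nat_mono card_mono growth(1)) auto
    also have "\<dots> \<le> C * (2 * 2 ^ j) ^ k" using \<open>1 \<le> 2 * (2::real) ^ j\<close> by (rule growth(2))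
    finally show "real (card L) \<le> C * (2 * 2 ^ j) ^ k" .
  qed simp
  also have "\<dots> = C * 2 ^ k * (2 powr (k - a)) ^ j"
    by (simp add: power_mult_distrib powr_realpow[symmetric] powr_powr powr_add[symmetric]
        algebra_simps)
  finally show ?thesis .
qed

lemma summable_on_powr_if_polynomial_growth:
  fixes f :: "'i \<Rightarrow> real"
  assumes ge_1: "\<And>i. i \<in> I \<Longrightarrow> 1 \<le> f i"
    and growth: "\<And>R. 1 \<le> R \<Longrightarrow> finite {i \<in> I. f i \<le> R}"
      "\<And>R. 1 \<le> R \<Longrightarrow> real (card {i \<in> I. f i \<le> R}) \<le> C * R ^ k"
    and "real k < a"
  shows "(\<lambda>i. f i powr - a) summable_on I"
proof (rule nonneg_bdd_above_summable_on)
  define level where "level i = nat \<lfloor>log 2 (f i)\<rfloor>" for i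
  have level: "2 ^ level i \<le> f i" "f i \<le> 2 * 2 ^ level i" if "i \<in> I" for i
    using dyadic_bounds[OF ge_1[OF that] level_def] .
  define u where "u = (2::real) powr (k - a)"
  have u: "0 \<le> u" "u < 1" using \<open>k < a\<close> by (auto simp: u_def powr_less_one)
  have "0 \<le> C" using growth(2)[of 1] by (simp add: order_trans[of 0])
  show "bdd_above (sum (\<lambda>i. f i powr - a) ` {F. F \<subseteq> I \<and> finite F})"
  proof (rule bdd_aboveI2)
    fix F assume "F \<in> {F. F \<subseteq> I \<and> finite F}"
    then have F: "finite F" "F \<subseteq> I" by auto
    have "(\<Sum>i\<in>F. f i powr - a) = (\<Sum>j\<in>level ` F. \<Sum>i\<in>{i \<in> F. level i = j}. f i powr - a)"
      using F(1) by (intro sum.group[symmetric]) auto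
    also have "\<dots> \<le> (\<Sum>j\<in>level ` F. C * 2 ^ k * u ^ j)"
    proof (rule sum_mono)
      fix j
      show "(\<Sum>i\<in>{i \<in> F. level i = j}. f i powr - a) \<le> C * 2 ^ k * u ^ j"
        unfolding u_def using growth level F(2) \<open>k < a\<close>
        by (intro sum_powr_dyadic_level_le[where I = I]) auto
    qed
    also have "\<dots> = C * 2 ^ k * (\<Sum>j\<in>level ` F. u ^ j)" by (simp add: sum_distrib_left)
    also have "\<dots> \<le> C * 2 ^ k * (\<Sum>j. u ^ j)"
      using F(1) u \<open>0 \<le> C\<close> by (intro mult_left_mono sum_le_suminf summable_geometric) auto
    finally show "(\<Sum>i\<in>F. f i powr - a) \<le> C * 2 ^ k * (\<Sum>j. u ^ j)" .
  qed
qed simp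

definition bounded_fraction_pairs :: "(complex \<times> complex) set" where
  "bounded_fraction_pairs =
     {(p, q). p \<in> gauss_ints \<and> q \<in> gauss_ints \<and> q \<noteq> 0 \<and> cmod p \<le> 2 * cmod q}"

lemma summable_on_bounded_fraction_pairs:
  assumes "4 < a"
  shows "(\<lambda>i. cmod (snd i) powr - a) summable_on bounded_fraction_pairs"
proof (rule summable_on_powr_if_polynomial_growth)
  fix R :: real assume "1 \<le> R"
  let ?L = "{i \<in> bounded_fraction_pairs. cmod (snd i) \<le> R}"
  let ?A = "gauss_ints \<inter> cball (0::complex) (2 * R)" and ?B = "gauss_ints \<inter> cball (0::complex) R"
  have sub: "?L \<subseteq> ?A \<times> ?B" by (auto simp: bounded_fraction_pairs_def)
  have fin: "finite (?A \<times> ?B)" by (simp add: finite_gauss_ints_Int_cball)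
  with sub show "finite ?L" by (rule finite_subset)
  have "real (card ?L) \<le> card (?A \<times> ?B)" using fin sub by (intro of_nat_mono card_mono)
  also have "\<dots> \<le> (2 * (2 * R) + 1)\<^sup>2 * (2 * R + 1)\<^sup>2"
    unfolding card_cartesian_product of_nat_mult
    by (intro mult_mono card_gauss_ints_Int_cball_le) auto
  also have "\<dots> \<le> (5 * R)\<^sup>2 * (3 * R)\<^sup>2"
    using \<open>1 \<le> R\<close> by (intro mult_mono power_mono) auto
  finally show "real (card ?L) \<le> 225 * R ^ 4" by (simp add: power2_eq_square power4_eq_xxxx)
qed (use assms gauss_ints_norm_ge_1 in \<open>auto simp: bounded_fraction_pairs_def\<close>)

lemma countable_gauss_ints: "countable gauss_ints"
proof (rule countable_subset)
  show "gauss_ints \<subseteq> (\<lambda>(a, b). Complex a b) ` (\<int> \<times> \<int>)"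
  proof
    fix z assume "z \<in> gauss_ints"
    then show "z \<in> (\<lambda>(a, b). Complex a b) ` (\<int> \<times> \<int>)"
      by (intro image_eqI[of _ _ "(Re z, Im z)"]) (auto simp: gauss_ints_def)
  qed
qed (intro countable_image countable_SIGMA countable_int)

lemma unit_square_norm_le:
  assumes "z \<in> unit_square"
  shows "cmod z \<le> 1"
proof -
  have "cmod z \<le> \<bar>Re z\<bar> + \<bar>Im z\<bar>" by (rule cmod_le)
  also have "\<dots> \<le> 1" using assms by (auto simp: unit_square_def)
  finally show ?thesis .
qed

lemma numerator_norm_le:
  assumes "cmod z \<le> 1" "q \<noteq> 0" "cmod (z - p / q) \<le> e"
  shows "cmod p \<le> cmod q * (1 + e)"
proof -
  have "cmod (p / q) \<le> cmod z + cmod (z - p / q)"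
    using norm_triangle_ineq4[of z "z - p / q"] by simp
  also have "\<dots> \<le> 1 + e" using assms by simp
  finally show ?thesis using \<open>q \<noteq> 0\<close> by (simp add: norm_divide field_simps)
qed

definition gauss_approximations :: "(real \<Rightarrow> real) \<Rightarrow> complex \<Rightarrow> (complex \<times> complex) set" where
  "gauss_approximations \<psi> z =
     {(p, q). p \<in> gauss_ints \<and> q \<in> gauss_ints \<and> q \<noteq> 0 \<and> cmod (z - p / q) \<le> \<psi> (cmod q)}"

lemma approximable_set_altdef:
  "approximable_set \<psi> = {z \<in> unit_square - {0}. infinite (gauss_approximations \<psi> z)}"
  by (simp add: approximable_set_def gauss_approximations_def)

lemma finite_gauss_approximations_bounded_denominator:
  assumes mono: "antimono_on {0<..} \<psi>" and "cmod z \<le> 1"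
  shows "finite {(p, q) \<in> gauss_approximations \<psi> z. cmod q \<le> X}" (is "finite ?T")
proof (rule finite_subset)
  show "?T \<subseteq> (gauss_ints \<inter> cball 0 (X * (1 + \<psi> 1))) \<times> (gauss_ints \<inter> cball 0 X)"
  proof clarify
    fix p q assume "(p, q) \<in> gauss_approximations \<psi> z" and "cmod q \<le> X"
    then have ints: "p \<in> gauss_ints" "q \<in> gauss_ints" and "q \<noteq> 0"
      and close: "cmod (z - p / q) \<le> \<psi> (cmod q)" by (auto simp: gauss_approximations_def)
    have "1 \<le> cmod q" using ints \<open>q \<noteq> 0\<close> by (intro gauss_ints_norm_ge_1)
    then have "\<psi> (cmod q) \<le> \<psi> 1" by (intro monotone_onD[OF mono]) auto
    with close have close_1: "cmod (z - p / q) \<le> \<psi> 1" by linarith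
    have "cmod p \<le> cmod q * (1 + \<psi> 1)"
      using \<open>cmod z \<le> 1\<close> \<open>q \<noteq> 0\<close> close_1 by (rule numerator_norm_le)
    also have "\<dots> \<le> X * (1 + \<psi> 1)"
      using \<open>cmod q \<le> X\<close> close_1 norm_ge_zero[of "z - p / q"] by (intro mult_right_mono) linarith+
    finally show "p \<in> gauss_ints \<inter> cball 0 (X * (1 + \<psi> 1)) \<and> q \<in> gauss_ints \<inter> cball 0 X"
      using ints \<open>cmod q \<le> X\<close> by simp
  qed
qed (simp add: finite_gauss_ints_Int_cball)

lemma infinite_bounded_fraction_pairs_if_approximable:
  assumes mono: "antimono_on {0<..} \<psi>" and "0 < b"
    and ev: "\<forall>\<^sub>F x in at_top. \<psi> x \<le> x powr - b" and z: "z \<in> approximable_set \<psi>"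
  shows "infinite {(p, q) \<in> bounded_fraction_pairs. cmod (z - p / q) \<le> cmod q powr - b}"
    (is "infinite ?S")
proof
  assume fin: "finite ?S"
  let ?T = "gauss_approximations \<psi> z"
  obtain X where X: "\<And>x. X \<le> x \<Longrightarrow> \<psi> x \<le> x powr - b"
    using ev by (auto simp: eventually_at_top_linorder)
  have "cmod z \<le> 1" and "infinite ?T"
    using z unit_square_norm_le by (auto simp: approximable_set_altdef)
  have large: "(p, q) \<in> ?S" if pq: "(p, q) \<in> ?T" "X \<le> cmod q" for p q
  proof -
    have q: "q \<noteq> 0" "1 \<le> cmod q"
      using pq(1) gauss_ints_norm_ge_1 by (auto simp: gauss_approximations_def)
    have "cmod (z - p / q) \<le> \<psi> (cmod q)" using pq(1) by (simp add: gauss_approximations_def)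
    also have "\<dots> \<le> cmod q powr - b" using X pq(2) by blast
    finally have close: "cmod (z - p / q) \<le> cmod q powr - b" .
    also have "\<dots> \<le> 1" using q \<open>0 < b\<close> powr_mono2'[of "- b" 1 "cmod q"] by simp
    finally have "cmod p \<le> 2 * cmod q"
      using numerator_norm_le[OF \<open>cmod z \<le> 1\<close> \<open>q \<noteq> 0\<close>, of p 1] by simp
    with close pq(1) show ?thesis
      by (simp add: bounded_fraction_pairs_def gauss_approximations_def)
  qed
  have "?T \<subseteq> ?S \<union> {(p, q) \<in> ?T. cmod q \<le> X}"
  proof
    fix i assume "i \<in> ?T"
    with large[of "fst i" "snd i"] show "i \<in> ?S \<union> {(p, q) \<in> ?T. cmod q \<le> X}"
      by (cases "X \<le> cmod (snd i)") auto
  qed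
  then show False
    using fin finite_gauss_approximations_bounded_denominator[OF mono \<open>cmod z \<le> 1\<close>] \<open>infinite ?T\<close>
    by (meson finite_UnI finite_subset)
qed

lemma hausdorff_measure_approximable_eq_0:
  assumes mono: "antimono_on {0<..} \<psi>" and "0 < s" "4 < b * s"
    and ev: "\<forall>\<^sub>F x in at_top. \<psi> x \<le> x powr - b"
  shows "hausdorff_measure s (approximable_set \<psi>) = 0"
proof -
  let ?I = bounded_fraction_pairs
  define U where "U = (\<lambda>(p, q). cball (p / q :: complex) (cmod q powr - b))"
  have "0 < b * s" using \<open>4 < b * s\<close> by simp
  then have "0 < b" using \<open>0 < s\<close> by (simp add: zero_less_mult_iff)
  have limsup: "infinite {i \<in> ?I. z \<in> U i}" if "z \<in> approximable_set \<psi>" for z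
  proof -
    have "{i \<in> ?I. z \<in> U i} = {(p, q) \<in> ?I. cmod (z - p / q) \<le> cmod q powr - b}"
      by (auto simp: U_def dist_norm norm_minus_commute)
    then show ?thesis
      using infinite_bounded_fraction_pairs_if_approximable[OF mono \<open>0 < b\<close> ev that] by simp
  qed
  have "diameter (U i) powr s = 2 powr s * cmod (snd i) powr - (b * s)" for i
    by (simp add: U_def split_beta powr_mult powr_powr)
  then have summable: "(\<lambda>i. diameter (U i) powr s) summable_on ?I"
    using summable_on_bounded_fraction_pairs[OF \<open>4 < b * s\<close>] by (simp add: summable_on_cmult_right)
  have "countable ?I"
    by (rule countable_subset[OF _ countable_SIGMA[OF countable_gauss_ints countable_gauss_ints]])
      (auto simp: bounded_fraction_pairs_def)
  then show ?thesis
    using \<open>0 < s\<close> _ summable limsup by (rule hausdorff_cantelli) (auto simp: U_def)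
qed

definition gauss_balls :: "(real \<Rightarrow> real) \<Rightarrow> (complex \<times> real) set" where
  "gauss_balls \<psi> =
     {(p / q, r) | p q r. p \<in> gauss_ints \<and> q \<in> gauss_ints \<and> q \<noteq> 0 \<and> 0 < r \<and> r \<le> \<psi> (cmod q)}"

lemma infinite_gauss_approximations_fraction:
  assumes pos: "\<And>x. 0 < x \<Longrightarrow> 0 < \<psi> x" and pq: "p \<in> gauss_ints" "q \<in> gauss_ints" "q \<noteq> 0"
  shows "infinite (gauss_approximations \<psi> (p / q))"
proof -
  let ?f = "\<lambda>n. (of_nat (Suc n) * p, of_nat (Suc n) * q)"
  have "?f n \<in> gauss_approximations \<psi> (p / q)" for n
  proof -
    have "of_nat (Suc n) * q \<noteq> 0" using pq by (simp del: of_nat_Suc)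
    then have "0 < \<psi> (cmod (of_nat (Suc n) * q))" by (intro pos) simp
    then show ?thesis
      using pq by (auto simp: gauss_approximations_def simp del: of_nat_Suc
          intro: gauss_ints_mult gauss_ints_of_nat)
  qed
  then have "range ?f \<subseteq> gauss_approximations \<psi> (p / q)" by blast
  moreover have "inj ?f" using pq by (intro injI) (simp del: of_nat_Suc)
  ultimately show ?thesis using infinite_super range_inj_infinite by blast
qed

lemma limsup_gauss_balls_imp_close_approximation:
  assumes "z \<in> limsup_balls (gauss_balls \<psi>)" "0 < e"
  shows "\<exists>(p, q)\<in>gauss_approximations \<psi> z. cmod (z - p / q) < e"
proof -
  obtain g r where "(g, r) \<in> gauss_balls \<psi>" and r: "r < e" "dist g z \<le> r"
    using assms by (auto simp: limsup_balls_def)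
  then obtain p q where "g = p / q" "r \<le> \<psi> (cmod q)" "p \<in> gauss_ints" "q \<in> gauss_ints" "q \<noteq> 0"
    by (auto simp: gauss_balls_def)
  with r show ?thesis
    by (intro bexI[of _ "(p, q)"])
      (auto simp: gauss_approximations_def dist_norm norm_minus_commute)
qed

lemma limsup_gauss_balls_subset_approximable:
  assumes pos: "\<And>x. 0 < x \<Longrightarrow> 0 < \<psi> x"
  shows "(unit_square - {0}) \<inter> limsup_balls (gauss_balls \<psi>) \<subseteq> approximable_set \<psi>"
proof
  fix z assume z: "z \<in> (unit_square - {0}) \<inter> limsup_balls (gauss_balls \<psi>)"
  let ?T = "gauss_approximations \<psi> z" and ?err = "\<lambda>(p, q). cmod (z - p / q)"
  have "infinite ?T"
  proof (cases "\<exists>p\<in>gauss_ints. \<exists>q\<in>gauss_ints. q \<noteq> 0 \<and> z = p / q")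
    case True
    then obtain p q where "p \<in> gauss_ints" "q \<in> gauss_ints" "q \<noteq> 0" "z = p / q" by blast
    then show ?thesis using infinite_gauss_approximations_fraction[of \<psi> p q] pos by simp
  next
    case False
    have err_pos: "0 < ?err i" if i: "i \<in> ?T" for i
    proof -
      obtain p q where "i = (p, q)" "p \<in> gauss_ints" "q \<in> gauss_ints" "q \<noteq> 0"
        using i by (auto simp: gauss_approximations_def)
      with False show ?thesis by auto
    qed
    show ?thesis
    proof
      assume fin: "finite ?T"
      have close: "\<exists>i\<in>?T. ?err i < e" if "0 < e" for e
        using limsup_gauss_balls_imp_close_approximation[of z \<psi> e] z that by (simp add: split_beta)
      have "?T \<noteq> {}" using close[of 1] by auto
      then have "0 < Min (?err ` ?T)" using fin err_pos by (subst Min_gr_iff) auto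
      then obtain i where i: "i \<in> ?T" "?err i < Min (?err ` ?T)" using close by blast
      have "Min (?err ` ?T) \<le> ?err i" using fin i(1) by (intro Min_le) auto
      with i(2) show False by simp
    qed
  qed
  then show "z \<in> approximable_set \<psi>" using z by (simp add: approximable_set_altdef)
qed

lemma cball_subset_punctured_square: "cball (1 / 4) (1 / 8) \<subseteq> unit_square - {0}"
proof
  fix z :: complex assume "z \<in> cball (1 / 4) (1 / 8)"
  then have "cmod (1 / 4 - z) \<le> 1 / 8" by (simp add: dist_norm)
  moreover have "Re (1 / 4 - z) = 1 / 4 - Re z" "Im (1 / 4 - z) = - Im z" by simp_all
  ultimately have "\<bar>1 / 4 - Re z\<bar> \<le> 1 / 8" "\<bar>- Im z\<bar> \<le> 1 / 8"
    using abs_Re_le_cmod[of "1 / 4 - z"] abs_Im_le_cmod[of "1 / 4 - z"] by linarith+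
  then have "1 / 8 \<le> Re z" "Re z < 1 / 2" "- 1 / 2 \<le> Im z" "Im z < 1 / 2"
    unfolding abs_le_iff by linarith+
  then show "z \<in> unit_square - {0}" by (auto simp: unit_square_def)
qed

lemma cball_Int_limsup_gauss_balls_subset_approximable:
  assumes "\<And>x. 0 < x \<Longrightarrow> 0 < \<psi> x"
  shows "cball (1 / 4) (1 / 8) \<inter> limsup_balls (gauss_balls \<psi>) \<subseteq> approximable_set \<psi>"
  by (rule order_trans[OF Int_mono[OF cball_subset_punctured_square order_refl]
        limsup_gauss_balls_subset_approximable[OF assms]])

lemma gauss_balls_dense:
  assumes pos: "\<And>x. 0 < x \<Longrightarrow> 0 < \<psi> x" and "0 < e"
  shows "\<exists>(g, r)\<in>gauss_balls \<psi>. dist g z < e \<and> 0 < r \<and> r < e"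
proof -
  define Q where "Q = 8 / e + 2"
  have "2 \<le> Q" "8 / Q < e" using \<open>0 < e\<close> by (auto simp: Q_def field_simps)
  obtain p q where pq: "p \<in> gauss_ints" "q \<in> gauss_ints" "q \<noteq> 0"
    and "dist (p / q) z \<le> 8 / (Q * cmod q)"
    using gauss_dirichlet[OF \<open>2 \<le> Q\<close>] by metis
  note this(4)
  also have "8 / (Q * cmod q) \<le> 8 / Q"
    using gauss_ints_norm_ge_1[OF pq(2,3)] \<open>2 \<le> Q\<close> pq by (intro divide_left_mono mult_pos_pos) auto
  finally have "dist (p / q) z < e" using \<open>8 / Q < e\<close> by simp
  moreover have "(p / q, min (\<psi> (cmod q)) (e / 2)) \<in> gauss_balls \<psi>"
    using pq pos[of "cmod q"] \<open>0 < e\<close> by (fastforce simp: gauss_balls_def)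
  ultimately show ?thesis
    using pos[of "cmod q"] pq \<open>0 < e\<close>
    by (intro bexI[of _ "(p / q, min (\<psi> (cmod q)) (e / 2))"]) auto
qed

lemma packing_dim_approximable:
  assumes "\<And>x. 0 < x \<Longrightarrow> 0 < \<psi> x"
  shows "packing_dim (approximable_set \<psi>) = 2"
proof (rule antisym)
  show "packing_dim (approximable_set \<psi>) \<le> 2"
    using packing_dim_le_DIM[of "approximable_set \<psi>"] by simp
  have "ball (1 / 4) (1 / 8) \<inter> limsup_balls (gauss_balls \<psi>) \<subseteq> approximable_set \<psi>"
    by (rule order_trans[OF Int_mono[OF ball_subset_cball order_refl]
          cball_Int_limsup_gauss_balls_subset_approximable[OF assms]])
  then have "packing_dim (ball (1 / 4) (1 / 8) \<inter> limsup_balls (gauss_balls \<psi>))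
      \<le> packing_dim (approximable_set \<psi>)"
    by (rule packing_dim_mono)
  moreover have "packing_dim (ball (1 / 4) (1 / 8) \<inter> limsup_balls (gauss_balls \<psi>)) = DIM(complex)"
    by (rule packing_dim_limsup_balls_dense) (simp_all add: gauss_balls_dense[OF assms])
  ultimately show "2 \<le> packing_dim (approximable_set \<psi>)" by simp
qed

lemma branches_gauss_balls:
  assumes mono: "antimono_on {0<..} \<psi>" and r: "0 < r" "r \<le> 1"
    and t: "t powr - b < \<psi> t" "2 * t powr (2 - b) < 1" "M * t powr (b * s - 4) < 1"
      "240 / (r / 4)\<^sup>2 \<le> t"
  shows "branches s (1 / (32 * 1920\<^sup>2)) M (gauss_balls \<psi>) y r"
proof -
  have tr: "3840 \<le> t * r\<^sup>2" using t(4) r by (simp add: field_simps)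
  have "0 < 240 / (r / 4)\<^sup>2" using r by simp
  then have "0 < t" using t(4) by linarith
  have "r\<^sup>2 \<le> r" "r\<^sup>2 \<le> 1" using r by (auto simp: power2_eq_square mult_left_le intro: mult_le_one)
  then have "t * r\<^sup>2 \<le> t * r" "t * r\<^sup>2 \<le> t * 1" using \<open>0 < t\<close> by (intro mult_left_mono; simp)+
  with tr have "1 \<le> t * r" "1 \<le> t" by linarith+
  define G where "G = gauss_fractions t \<inter> cball y (r / 2)"
  have "separated (1 / t\<^sup>2) G"
    using separated_gauss_fractions by (rule separated_subset) (simp add: G_def)
  moreover have "1 / (32 * 1920\<^sup>2) * (r / (1 / t\<^sup>2))\<^sup>2 \<le> card G"
    using card_gauss_fractions_Int_cball_ge[of "r / 4" t y] r t(4)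
    by (simp add: G_def power_divide power_mult_distrib)
  moreover have "2 * t powr - b \<le> 1 / t\<^sup>2"
    using t(2) \<open>0 < t\<close> by (simp add: powr_diff powr_minus_divide powr_numeral field_simps)
  moreover have "1 / t\<^sup>2 \<le> r"
    using mult_mono[OF \<open>1 \<le> t\<close> \<open>1 \<le> t * r\<close>] \<open>0 < t\<close> by (simp add: field_simps power2_eq_square)
  moreover have "M * (1 / t\<^sup>2)\<^sup>2 \<le> (t powr - b) powr s"
  proof -
    have "M * (1 / t\<^sup>2)\<^sup>2 = M * t powr (b * s - 4) * t powr - (b * s)"
      using \<open>0 < t\<close>
      by (simp add: powr_diff powr_minus_divide powr_numeral power_divide flip: power_mult)
    also have "\<dots> \<le> 1 * t powr - (b * s)" using t(3) by (intro mult_right_mono) auto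
    finally show ?thesis by (simp add: powr_powr)
  qed
  moreover have "(g, t powr - b) \<in> gauss_balls \<psi>" if "g \<in> G" for g
  proof -
    obtain p q where pq: "p \<in> gauss_ints" "q \<in> gauss_ints" "q \<noteq> 0" "cmod q \<le> t" "g = p / q"
      using \<open>g \<in> G\<close> by (auto simp: G_def gauss_fractions_def)
    have "\<psi> t \<le> \<psi> (cmod q)" using pq \<open>0 < t\<close> by (intro monotone_onD[OF mono]) auto
    then have "0 < t powr - b" "t powr - b \<le> \<psi> (cmod q)" using t(1) \<open>0 < t\<close> by auto
    with pq show ?thesis by (auto simp: gauss_balls_def)
  qed
  ultimately show ?thesis
    unfolding branches_def DIM_complex using \<open>0 < t\<close>
    by (intro exI[of _ G] exI[of _ "1 / t\<^sup>2"] exI[of _ "t powr - b"]) (auto simp: G_def)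
qed

lemma ubiquitous_gauss_balls:
  assumes mono: "antimono_on {0<..} \<psi>" and b: "2 < b" "b * s < 4"
    and freq: "\<exists>\<^sub>F t in at_top. t powr - b < \<psi> t"
  shows "ubiquitous s (1 / (32 * 1920\<^sup>2)) (gauss_balls \<psi>)"
  unfolding ubiquitous_def
proof (intro allI impI)
  fix y :: complex and r M :: real assume r: "0 < r" "r \<le> 1"
  have lim: "((\<lambda>t. k * t powr e) \<longlongrightarrow> 0) at_top" if "e < 0" for k e :: real
    using that by (intro tendsto_mult_right_zero tendsto_neg_powr filterlim_ident)
  have "\<forall>\<^sub>F t in at_top. 2 * t powr (2 - b) < 1"
    by (rule order_tendstoD(2)[OF lim]) (use b in auto)
  moreover have "\<forall>\<^sub>F t in at_top. M * t powr (b * s - 4) < 1"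
    by (rule order_tendstoD(2)[OF lim]) (use b in auto)
  moreover have "\<forall>\<^sub>F t in at_top. 240 / (r / 4)\<^sup>2 \<le> t" by (rule eventually_ge_at_top)
  ultimately have "\<forall>\<^sub>F t in at_top. 2 * t powr (2 - b) < 1 \<and> M * t powr (b * s - 4) < 1
      \<and> 240 / (r / 4)\<^sup>2 \<le> t"
    by eventually_elim blast
  then obtain t where t: "t powr - b < \<psi> t" "2 * t powr (2 - b) < 1" "M * t powr (b * s - 4) < 1"
      "240 / (r / 4)\<^sup>2 \<le> t"
    using frequently_ex[OF frequently_eventually_conj[OF freq]] by blast
  show "branches s (1 / (32 * 1920\<^sup>2)) M (gauss_balls \<psi>) y r"
    using mono r t by (rule branches_gauss_balls)
qed

subsection \<open>The dimension formulas\<close>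

lemma lower_order_less_imp_frequently:
  assumes pos: "\<And>x. 0 < x \<Longrightarrow> 0 < \<psi> x" and less: "lower_order \<psi> < ereal b"
  shows "\<exists>\<^sub>F x in at_top. x powr - b < \<psi> x"
proof (rule ccontr)
  assume "\<not> ?thesis"
  then have "\<forall>\<^sub>F x in at_top. \<psi> x \<le> x powr - b" by (simp add: not_frequently not_less)
  then have "\<forall>\<^sub>F x in at_top. ereal b \<le> ereal (- ln (\<psi> x) / ln x)"
    using eventually_gt_at_top[of 1]
  proof eventually_elim
    case (elim x)
    then have "ln (\<psi> x) \<le> ln (x powr - b)" using pos[of x] by (subst ln_le_cancel_iff) auto
    then have "b * ln x \<le> - ln (\<psi> x)" using elim by (simp add: ln_powr)
    moreover have "0 < ln x" using elim by simp
    ultimately show ?case by (simp add: field_simps)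
  qed
  then have "ereal b \<le> lower_order \<psi>" unfolding lower_order_def by (rule Liminf_bounded)
  with less show False by simp
qed

lemma less_lower_order_imp_eventually:
  assumes pos: "\<And>x. 0 < x \<Longrightarrow> 0 < \<psi> x" and less: "ereal b < lower_order \<psi>"
  shows "\<forall>\<^sub>F x in at_top. \<psi> x \<le> x powr - b"
proof -
  have "\<forall>\<^sub>F x in at_top. ereal b < ereal (- ln (\<psi> x) / ln x)"
    using less unfolding lower_order_def by (rule less_LiminfD)
  then show ?thesis
    using eventually_gt_at_top[of 1]
  proof eventually_elim
    case (elim x)
    then have "0 < ln x" by simp
    with elim have "b * ln x < - ln (\<psi> x)" by (simp add: field_simps)
    then have "ln (\<psi> x) \<le> ln (x powr - b)" using elim by (simp add: ln_powr)
    then show ?case using pos[of x] elim by (subst (asm) ln_le_cancel_iff) auto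
  qed
qed

lemma lower_order_nonneg:
  assumes pos: "\<And>x. 0 < x \<Longrightarrow> 0 < \<psi> x" and lim: "(\<psi> \<longlongrightarrow> 0) at_top"
  shows "0 \<le> lower_order \<psi>"
proof -
  have "\<forall>\<^sub>F x in at_top. \<psi> x < 1" using lim by (rule order_tendstoD) simp
  then have "\<forall>\<^sub>F x in at_top. 0 \<le> ereal (- ln (\<psi> x) / ln x)"
    using eventually_gt_at_top[of 1]
  proof eventually_elim
    case (elim x)
    then have "ln (\<psi> x) \<le> 0" "0 < ln x" using pos[of x] by auto
    then show ?case by (simp add: divide_nonpos_pos)
  qed
  then show ?thesis unfolding lower_order_def by (rule Liminf_bounded)
qed

lemma
  fixes l :: ereal and a s :: real
  assumes "0 \<le> l" "0 < a" "0 < s"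
  shows ereal_less_divide_swap: "ereal s < ereal a / l \<longleftrightarrow> l < ereal (a / s)"
    and ereal_divide_less_swap: "ereal a / l < ereal s \<longleftrightarrow> ereal (a / s) < l"
proof -
  consider "l = 0" | t where "l = ereal t" "0 < t" | "l = \<infinity>"
    using assms(1) by (cases l) force+
  then have "(ereal s < ereal a / l \<longleftrightarrow> l < ereal (a / s)) \<and>
      (ereal a / l < ereal s \<longleftrightarrow> ereal (a / s) < l)"
  proof cases
    case 2
    then show ?thesis using assms by (simp add: field_simps)
  qed (use assms in \<open>auto simp: divide_ereal_def divide_less_0_iff\<close>)
  then show "ereal s < ereal a / l \<longleftrightarrow> l < ereal (a / s)"
    and "ereal a / l < ereal s \<longleftrightarrow> ereal (a / s) < l" by auto
qed

lemma hausdorff_dim_approximable_le: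
  assumes pos: "\<And>x. 0 < x \<Longrightarrow> 0 < \<psi> x" and mono: "antimono_on {0<..} \<psi>"
    and lim: "(\<psi> \<longlongrightarrow> 0) at_top"
  shows "hausdorff_dim (approximable_set \<psi>) \<le> 4 / lower_order \<psi>"
proof (rule dense_ge)
  let ?l = "lower_order \<psi>"
  have "0 \<le> ?l" using pos lim by (rule lower_order_nonneg)
  fix y assume "4 / ?l < y"
  then obtain s where s: "ereal 4 / ?l < ereal s" "ereal s < y" using ereal_dense2 by auto
  have "0 \<le> ereal 4 / ?l" using \<open>0 \<le> ?l\<close> by (cases ?l) (auto simp: divide_ereal_def)
  then have "0 < ereal s" using s(1) by (rule order_le_less_trans)
  then have "0 < s" by simp
  then have "ereal (4 / s) < ?l"
    using s(1) ereal_divide_less_swap[OF \<open>0 \<le> ?l\<close>, of 4 s] by simp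
  then obtain b where b: "4 / s < b" "ereal b < ?l" using ereal_dense2 by fastforce
  have "4 < b * s" using b(1) \<open>0 < s\<close> by (simp add: field_simps)
  then have "hausdorff_measure s (approximable_set \<psi>) = 0"
    using mono \<open>0 < s\<close> less_lower_order_imp_eventually[OF pos b(2)]
    by (intro hausdorff_measure_approximable_eq_0)
  then have "hausdorff_dim (approximable_set \<psi>) \<le> ereal s"
    using \<open>0 < s\<close> by (intro hausdorff_dim_le) auto
  then show "hausdorff_dim (approximable_set \<psi>) \<le> y" using s(2) by order
qed

lemma le_hausdorff_dim_approximable:
  assumes pos: "\<And>x. 0 < x \<Longrightarrow> 0 < \<psi> x" and mono: "antimono_on {0<..} \<psi>"
    and s: "0 < s" "s < 2" and l: "lower_order \<psi> < ereal (4 / s)"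
  shows "ereal s \<le> hausdorff_dim (approximable_set \<psi>)"
proof (rule le_hausdorff_dim)
  have "2 < 4 / s" using s by (simp add: field_simps)
  with l have "max (lower_order \<psi>) (ereal 2) < ereal (4 / s)" by simp
  then obtain b where "max (lower_order \<psi>) (ereal 2) < ereal b" "ereal b < ereal (4 / s)"
    using ereal_dense2 by blast
  then have b: "lower_order \<psi> < ereal b" "2 < b" "b * s < 4"
    using \<open>0 < s\<close> by (auto simp: field_simps)
  have "ubiquitous s (1 / (32 * 1920\<^sup>2)) (gauss_balls \<psi>)"
    using mono b(2,3) lower_order_less_imp_frequently[OF pos b(1)] by (rule ubiquitous_gauss_balls)
  then have "hausdorff_measure s (cball (1 / 4) (1 / 8) \<inter> limsup_balls (gauss_balls \<psi>)) \<noteq> 0"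
    by (rule hausdorff_measure_ubiquitous_neq_0) (use s in auto)
  then show "hausdorff_measure s (approximable_set \<psi>) \<noteq> 0"
    using hausdorff_measure_mono[OF cball_Int_limsup_gauss_balls_subset_approximable[of \<psi>, OF pos],
        where s = s] by auto
qed

lemma min_le_hausdorff_dim_approximable:
  assumes pos: "\<And>x. 0 < x \<Longrightarrow> 0 < \<psi> x" and mono: "antimono_on {0<..} \<psi>"
    and lim: "(\<psi> \<longlongrightarrow> 0) at_top"
  shows "min (4 / lower_order \<psi>) 2 \<le> hausdorff_dim (approximable_set \<psi>)"
proof (rule ccontr)
  let ?l = "lower_order \<psi>"
  have "0 \<le> ?l" using pos lim by (rule lower_order_nonneg)
  assume "\<not> ?thesis"
  then have "hausdorff_dim (approximable_set \<psi>) < min (4 / ?l) 2" by (simp only: not_le)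
  then obtain s where s: "hausdorff_dim (approximable_set \<psi>) < ereal s" "ereal s < min (4 / ?l) 2"
    using ereal_dense2 by blast
  have "0 \<le> hausdorff_dim (approximable_set \<psi>)"
    unfolding hausdorff_dim_def by (rule Inf_greatest) auto
  then have "0 < ereal s" using s(1) by (rule order_le_less_trans)
  then have "0 < s" by simp
  moreover have "s < 2" using s(2) by (metis less_ereal.simps(1) min_less_iff_conj numeral_eq_ereal)
  moreover have "?l < ereal (4 / s)"
    using s(2) \<open>0 < s\<close> ereal_less_divide_swap[OF \<open>0 \<le> ?l\<close>, of 4 s] by simp
  ultimately have "ereal s \<le> hausdorff_dim (approximable_set \<psi>)"
    by (intro le_hausdorff_dim_approximable pos mono)
  with s(1) show False by simp
qed

theorem theorem1p2:
  fixes \<psi> :: "real \<Rightarrow> real"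
  assumes "\<And>x. 0 < x \<Longrightarrow> 0 < \<psi> x"
    and "antimono_on {0<..} \<psi>"
    and "(\<psi> \<longlongrightarrow> 0) at_top"
  shows "hausdorff_dim (approximable_set \<psi>) = min (4 / lower_order \<psi>) 2 \<and>
         packing_dim (approximable_set \<psi>) = 2"
proof
  show packing: "packing_dim (approximable_set \<psi>) = 2"
    using assms(1) by (rule packing_dim_approximable)
  have "hausdorff_dim (approximable_set \<psi>) \<le> 2"
    using hausdorff_dim_le_packing_dim[of "approximable_set \<psi>"] by (simp only: packing)
  moreover have "hausdorff_dim (approximable_set \<psi>) \<le> 4 / lower_order \<psi>"
    using assms by (rule hausdorff_dim_approximable_le)
  moreover have "min (4 / lower_order \<psi>) 2 \<le> hausdorff_dim (approximable_set \<psi>)"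
    using assms by (rule min_le_hausdorff_dim_approximable)
  ultimately show "hausdorff_dim (approximable_set \<psi>) = min (4 / lower_order \<psi>) 2"
    by (intro antisym) auto
qed

end
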